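(* Let $\tilde I\subset(0,\infty)$ be a compact interval, let $\sigma_0:\mathbb R\to\tilde I$ have bounded total variation, and let $G:\tilde I\to\mathbb R$ be of class $\mathcal C^2$ with $G'(\sigma)>0$ for all $\sigma\in\tilde I$. Let $(\eta,v)\in\mathcal C((0,\infty);BV^2)$ be the admissible weak solution of $$\eta_t-G\left(\frac{v}{\eta}\right)_x=0,\quad \eta(x,0)=1,\qquad\qquad v_t=0,\quad v(x,0)=\sigma_0(x),\qquad x\in\mathbb R,\ t>0.$$ Then the distributional solution $\gamma$ of $$\gamma_x(x,t)=\eta(x,t),\qquad\gamma_t(x,t)=G\left(\frac{v(x,t)}{\eta(x,t)}\right),\qquad\gamma(x,0)=x$$ is well defined (there is exactly one continuous $\gamma:\mathbb R\times[0,\infty)\to\mathbb R$ with $\gamma(x,0)=x$ satisfying the two equations in the sense of distributions on $\mathbb R\times(0,\infty)$), and for each fixed $t>0$ the map $x\mapsto\gamma(x,t)$ is absolutely continuous and invertible as a map $\mathbb R\to\mathbb R$, with absolutely continuous inverse $\gamma^{-1}(\cdot,t)$.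
   Context: State space: $\Omega=\{(\eta,v)\in\mathbb R^2:\eta>0,\ v/\eta\in\tilde I\}$; solutions take values in $\Omega$. Weak solution: a bounded measurable $w=(\eta,v):\mathbb R\times[0,\infty)\to\Omega$ such that $t\mapsto w(\cdot,t)$ is continuous from $[0,\infty)$ into $L^1_{loc}(\mathbb R;\mathbb R^2)$, attains the prescribed initial data at $t=0$, and satisfies both equations in the sense of distributions on $\mathbb R\times(0,\infty)$. Convex extension of the system: a pair $(\mathcal E,\mathcal Q)$ of $\mathcal C^1$ functions on $\Omega$ with $\mathcal E$ smooth and convex, $\mathcal Q_\eta=\mathcal E_\eta\frac{v}{\eta^2}G'(\frac v\eta)$ and $\mathcal Q_v=-\mathcal E_\eta\frac1\eta G'(\frac v\eta)$. Admissible weak solution: a weak solution such that for every convex extension $(\mathcal E,\mathcal Q)$ and every nonnegative $\psi\in\mathcal C^1_c(\mathbb R\times(0,\infty))$ one has $\iint(\psi_t\,\mathcal E(w)+\psi_x\,\mathcal Q(w))\,dx\,dt\ge0$. It may be taken as known that such a solution exists and is unique in $\mathcal C((0,\infty);BV^2)$. $(\eta,v)\in\mathcal C((0,\infty);BV^2)$ means: for each $t>0$, $\eta(\cdot,t)$ and $v(\cdot,t)$ have bounded total variation on $\mathbb R$, and $t\mapsto(\eta,v)(\cdot,t)$ is continuous in $L^1_{loc}(\mathbb R)$. Absolutely continuous on $\mathbb R$ means absolutely continuous on every bounded interval. *)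

theory Defs
  imports "HOL-Analysis.Analysis"
begin

text \<open>Functions of \<open>(x, t)\<close> with \<open>x\<close> real and \<open>t \<ge> 0\<close> are total functions on
  \<^typ>\<open>real \<times> real\<close>, whose values for \<open>t < 0\<close> are never used.\<close>

abbreviation half_plane :: "(real \<times> real) set" where
  "half_plane \<equiv> UNIV \<times> {0<..}"

abbreviation closed_half_plane :: "(real \<times> real) set" where
  "closed_half_plane \<equiv> UNIV \<times> {0..}"


text \<open>On a set that is not open, derivatives are taken within the set (so they are one-sided at
  the ends of an interval).  They are unique on a convex set with nonempty interior.\<close>

primrec Ck_on :: "nat \<Rightarrow> 'a::euclidean_space set \<Rightarrow> ('a \<Rightarrow> real) \<Rightarrow> bool" where
  "Ck_on 0 S f \<longleftrightarrow> continuous_on S f"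
| "Ck_on (Suc k) S f \<longleftrightarrow>
     (\<exists>D. (\<forall>p\<in>S. (f has_derivative D p) (at p within S)) \<and>
          (\<forall>b\<in>Basis. Ck_on k S (\<lambda>p. D p b)))"

definition smooth_on :: "'a::euclidean_space set \<Rightarrow> ('a \<Rightarrow> real) \<Rightarrow> bool" where
  "smooth_on S f \<longleftrightarrow> (\<forall>k. Ck_on k S f)"

definition compact_support_in :: "'a::euclidean_space set \<Rightarrow> ('a \<Rightarrow> real) \<Rightarrow> bool" where
  "compact_support_in U f \<longleftrightarrow>
     compact (closure {p. f p \<noteq> 0}) \<and> closure {p. f p \<noteq> 0} \<subseteq> U"

definition dx :: "(real \<times> real \<Rightarrow> real) \<Rightarrow> real \<times> real \<Rightarrow> real" where
  "dx \<phi> p = deriv (\<lambda>y. \<phi> (y, snd p)) (fst p)"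

definition dt :: "(real \<times> real \<Rightarrow> real) \<Rightarrow> real \<times> real \<Rightarrow> real" where
  "dt \<phi> p = deriv (\<lambda>s. \<phi> (fst p, s)) (snd p)"

text \<open>A function in \<open>C\<^sub>c\<close> of the open half plane is represented by its extension by zero.\<close>

definition C1c_test :: "(real \<times> real \<Rightarrow> real) \<Rightarrow> bool" where
  "C1c_test \<psi> \<longleftrightarrow> Ck_on 1 UNIV \<psi> \<and> compact_support_in half_plane \<psi>"

definition smooth_test :: "(real \<times> real \<Rightarrow> real) \<Rightarrow> bool" where
  "smooth_test \<phi> \<longleftrightarrow> smooth_on UNIV \<phi> \<and> compact_support_in half_plane \<phi>"


definition bounded_total_variation :: "(real \<Rightarrow> real) \<Rightarrow> bool" where
  "bounded_total_variation f \<longleftrightarrow>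
     (\<exists>B. \<forall>n. \<forall>x :: nat \<Rightarrow> real. mono x \<longrightarrow> (\<Sum>i<n. \<bar>f (x (Suc i)) - f (x i)\<bar>) \<le> B)"

definition abs_continuous_on_interval :: "real \<Rightarrow> real \<Rightarrow> (real \<Rightarrow> real) \<Rightarrow> bool" where
  "abs_continuous_on_interval c d f \<longleftrightarrow>
     (\<forall>\<epsilon>>0. \<exists>\<delta>>0. \<forall>n. \<forall>l u :: nat \<Rightarrow> real.
        (\<forall>i<n. c \<le> l i \<and> l i \<le> u i \<and> u i \<le> d) \<longrightarrow>
        disjoint_family_on (\<lambda>i. {l i<..<u i}) {..<n} \<longrightarrow>
        (\<Sum>i<n. u i - l i) < \<delta> \<longrightarrow>
        (\<Sum>i<n. \<bar>f (u i) - f (l i)\<bar>) < \<epsilon>)"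

definition abs_continuous :: "(real \<Rightarrow> real) \<Rightarrow> bool" where
  "abs_continuous f \<longleftrightarrow> (\<forall>c d. abs_continuous_on_interval c d f)"

text \<open>Continuity of \<open>t \<mapsto> f(\<cdot>, t)\<close> from \<open>T\<close> into \<open>L\<^sup>1\<^sub>l\<^sub>o\<^sub>c(\<real>)\<close>.\<close>

definition L1loc_continuous_on :: "real set \<Rightarrow> (real \<times> real \<Rightarrow> real) \<Rightarrow> bool" where
  "L1loc_continuous_on T f \<longleftrightarrow>
     (\<forall>t\<in>T. \<forall>c d. (\<lambda>x. f (x, t)) absolutely_integrable_on {c..d}) \<and>
     (\<forall>t\<in>T. \<forall>c d.
        ((\<lambda>s. LINT x:{c..d}|lebesgue. \<bar>f (x, s) - f (x, t)\<bar>) \<longlongrightarrow> 0) (at t within T))"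

definition C_BV2 :: "(real \<times> real \<Rightarrow> real) \<Rightarrow> (real \<times> real \<Rightarrow> real) \<Rightarrow> bool" where
  "C_BV2 \<eta> v \<longleftrightarrow>
     (\<forall>t>0. bounded_total_variation (\<lambda>x. \<eta> (x, t)) \<and>
            bounded_total_variation (\<lambda>x. v (x, t))) \<and>
     L1loc_continuous_on {0<..} \<eta> \<and> L1loc_continuous_on {0<..} v"


definition state_space :: "real set \<Rightarrow> (real \<times> real) set" where
  "state_space I = {(\<eta>, v). \<eta> > 0 \<and> v / \<eta> \<in> I}"

text \<open>The initial data are attained as elements of \<open>L\<^sup>1\<^sub>l\<^sub>o\<^sub>c\<close>, that is, almost everywhere.\<close>

definition weak_solution ::
  "real set \<Rightarrow> (real \<Rightarrow> real) \<Rightarrow> (real \<Rightarrow> real) \<Rightarrow> (real \<Rightarrow> real) \<Rightarrow>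
   (real \<times> real \<Rightarrow> real) \<Rightarrow> (real \<times> real \<Rightarrow> real) \<Rightarrow> bool" where
  "weak_solution I G \<eta>\<^sub>0 v\<^sub>0 \<eta> v \<longleftrightarrow>
     (\<forall>p\<in>closed_half_plane. (\<eta> p, v p) \<in> state_space I) \<and>
     bounded ((\<lambda>p. (\<eta> p, v p)) ` closed_half_plane) \<and>
     (\<lambda>p. (\<eta> p, v p)) \<in> borel_measurable (lebesgue_on closed_half_plane) \<and>
     L1loc_continuous_on {0..} \<eta> \<and> L1loc_continuous_on {0..} v \<and>
     (AE x in lebesgue. \<eta> (x, 0) = \<eta>\<^sub>0 x \<and> v (x, 0) = v\<^sub>0 x) \<and>
     (\<forall>\<phi>. smooth_test \<phi> \<longrightarrow>
        (LINT p:half_plane|lebesgue. \<eta> p * dt \<phi> p - G (v p / \<eta> p) * dx \<phi> p) = 0) \<and>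
     (\<forall>\<phi>. smooth_test \<phi> \<longrightarrow> (LINT p:half_plane|lebesgue. v p * dt \<phi> p) = 0)"

text \<open>The function \<open>g\<close> is the derivative of the flux \<open>G\<close>, and \<open>E\<^sub>\<eta>\<close>, \<open>E\<^sub>v\<close> are the partial
  derivatives of the entropy \<open>E\<close>.\<close>

definition convex_extension ::
  "real set \<Rightarrow> (real \<Rightarrow> real) \<Rightarrow>
   (real \<times> real \<Rightarrow> real) \<Rightarrow> (real \<times> real \<Rightarrow> real) \<Rightarrow> bool" where
  "convex_extension I g E Q \<longleftrightarrow>
     smooth_on (state_space I) E \<and> convex_on (state_space I) E \<and>
     Ck_on 1 (state_space I) Q \<and>
     (\<exists>E\<^sub>\<eta> E\<^sub>v. \<forall>(\<eta>, v)\<in>state_space I.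
        (E has_derivative (\<lambda>(h, k). E\<^sub>\<eta> (\<eta>, v) * h + E\<^sub>v (\<eta>, v) * k))
          (at (\<eta>, v) within state_space I) \<and>
        (Q has_derivative (\<lambda>(h, k). (E\<^sub>\<eta> (\<eta>, v) * (v / \<eta>\<^sup>2) * g (v / \<eta>)) * h
                                    + (- E\<^sub>\<eta> (\<eta>, v) * (1 / \<eta>) * g (v / \<eta>)) * k))
          (at (\<eta>, v) within state_space I))"

definition admissible_weak_solution ::
  "real set \<Rightarrow> (real \<Rightarrow> real) \<Rightarrow> (real \<Rightarrow> real) \<Rightarrow> (real \<Rightarrow> real) \<Rightarrow> (real \<Rightarrow> real) \<Rightarrow>
   (real \<times> real \<Rightarrow> real) \<Rightarrow> (real \<times> real \<Rightarrow> real) \<Rightarrow> bool" where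
  "admissible_weak_solution I G g \<eta>\<^sub>0 v\<^sub>0 \<eta> v \<longleftrightarrow>
     weak_solution I G \<eta>\<^sub>0 v\<^sub>0 \<eta> v \<and>
     (\<forall>E Q \<psi>. convex_extension I g E Q \<longrightarrow> C1c_test \<psi> \<longrightarrow> (\<forall>p. \<psi> p \<ge> 0) \<longrightarrow>
        (LINT p:half_plane|lebesgue. dt \<psi> p * E (\<eta> p, v p) + dx \<psi> p * Q (\<eta> p, v p)) \<ge> 0)"

definition distributional_position ::
  "(real \<Rightarrow> real) \<Rightarrow> (real \<times> real \<Rightarrow> real) \<Rightarrow> (real \<times> real \<Rightarrow> real) \<Rightarrow>
   (real \<times> real \<Rightarrow> real) \<Rightarrow> bool" where
  "distributional_position G \<eta> v \<gamma> \<longleftrightarrow>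
     continuous_on closed_half_plane \<gamma> \<and>
     (\<forall>x. \<gamma> (x, 0) = x) \<and>
     (\<forall>\<phi>. smooth_test \<phi> \<longrightarrow>
        (LINT p:half_plane|lebesgue. \<gamma> p * dx \<phi> p) =
        - (LINT p:half_plane|lebesgue. \<eta> p * \<phi> p)) \<and>
     (\<forall>\<phi>. smooth_test \<phi> \<longrightarrow>
        (LINT p:half_plane|lebesgue. \<gamma> p * dt \<phi> p) =
        - (LINT p:half_plane|lebesgue. G (v p / \<eta> p) * \<phi> p))"

end

theory Submission
  imports Defs
begin

text \<open>Write \<open>F = G(v/\<eta>)\<close>.  Testing \<open>\<eta>\<^sub>t = F\<^sub>x\<close> with products \<open>a(x) b(t)\<close> and using the continuity of
  \<open>\<eta>\<close> in time gives, for every \<open>t\<close>, that \<open>\<integral> (\<eta>(x,t) - 1) a(x) dx = - \<integral> M(x,t) a'(x) dx\<close> with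
  \<open>M(x,t) = \<integral>\<^sub>0\<^sup>t F(x,s) ds\<close>.  By the du Bois-Reymond lemma \<open>x + M(x,t)\<close> and \<open>\<integral>\<^sub>0\<^sup>x \<eta>(y,t) dy\<close> differ, for
  almost every \<open>x\<close>, by a constant \<open>c(t)\<close>.  Then \<open>\<gamma>(x,t) = \<integral>\<^sub>0\<^sup>x \<eta>(y,t) dy + c(t)\<close> is continuous,
  its \<open>x\<close>-derivative is \<open>\<eta>\<close>, and since it agrees with \<open>x + M(x,t)\<close> almost everywhere its time derivative
  is \<open>F\<close>.  The difference of two solutions is constant in time and vanishes initially.

  The equation \<open>v\<^sub>t = 0\<close> yields \<open>v(\<cdot>,t) = \<sigma>\<^sub>0\<close> almost everywhere, hence
  \<open>\<eta> = v / (v/\<eta>) \<ge> min I / max I > 0\<close>, and \<open>\<gamma>(\<cdot>,t)\<close> is bi-Lipschitz.\<close>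

section \<open>Smooth functions\<close>

text \<open>The obstacle is regularity. F is known only up to a null set of the plane, so M(.,t) is
  merely bounded and measurable in x and cannot serve as \<gamma> itself; it enters only through
  integrals over x-intervals. For the same reason the du Bois-Reymond lemma is put in averaged form:
  all means over intervals agree. The constant c(t) is one such mean, and it is continuous in t by
  the L1 continuity of \<eta> and the Lipschitz bound on M(x,.). The statement concerns completed
  Lebesgue measure, while Fubini needs Borel functions. Two kinds of Borel versions of \<eta>
  therefore occur: one per time slice, valid for every t \<ge> 0 but without joint measurability,
  and one on the plane, whose slices agree with the former for almost every t. The slices carry
  statements at a fixed time, the planar version carries double integrals. The lower slope bound for
  \<gamma>(.,t) is likewise obtained from integrals: the equation for v is used as equality of the
  integrals of v(.,t) and v(.,0) over every interval.\<close>

lemma Ck_on_continuous: "Ck_on k S f \<Longrightarrow> continuous_on S f"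
proof (cases k)
  case (Suc j)
  assume "Ck_on k S f"
  then obtain D where "\<forall>p\<in>S. (f has_derivative D p) (at p within S)"
    using Suc by auto
  then show ?thesis
    by (meson continuous_on_eq_continuous_within has_derivative_continuous)
qed auto

lemma Ck_on_Suc_D: "Ck_on (Suc k) S f \<Longrightarrow> Ck_on k S f"
proof (induction k arbitrary: f)
  case 0
  then show ?case using Ck_on_continuous by fastforce
next
  case (Suc k)
  then obtain D where "\<forall>p\<in>S. (f has_derivative D p) (at p within S)"
    "\<forall>b\<in>Basis. Ck_on (Suc k) S (\<lambda>p. D p b)"
    unfolding Ck_on.simps(2)[of "Suc k"] by blast
  then have "(\<forall>p\<in>S. (f has_derivative D p) (at p within S)) \<and> (\<forall>b\<in>Basis. Ck_on k S (\<lambda>p. D p b))"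
    using Suc.IH by blast
  then show ?case unfolding Ck_on.simps(2)[of k] by (rule exI[of _ D])
qed

lemma Ck_on_const: "Ck_on k S (\<lambda>_. c)"
proof (induction k arbitrary: c)
  case (Suc k)
  then show ?case
    by (auto intro!: exI[of _ "\<lambda>_ _. 0"])
qed auto

lemma Ck_on_add: "Ck_on k S f \<Longrightarrow> Ck_on k S g \<Longrightarrow> Ck_on k S (\<lambda>x. f x + g x)"
proof (induction k arbitrary: f g)
  case 0
  then show ?case by (auto intro: continuous_intros)
next
  case (Suc k)
  from Suc.prems obtain D E where
    D: "\<And>p. p \<in> S \<Longrightarrow> (f has_derivative D p) (at p within S)" "\<And>b. b\<in>Basis \<Longrightarrow> Ck_on k S (\<lambda>p. D p b)" and
    E: "\<And>p. p \<in> S \<Longrightarrow> (g has_derivative E p) (at p within S)" "\<And>b. b\<in>Basis \<Longrightarrow> Ck_on k S (\<lambda>p. E p b)"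
    unfolding Ck_on.simps by metis
  then show ?case
    by (auto intro!: exI[of _ "\<lambda>p h. D p h + E p h"] derivative_intros Suc.IH)
qed

lemma Ck_on_mult: "Ck_on k S f \<Longrightarrow> Ck_on k S g \<Longrightarrow> Ck_on k S (\<lambda>x. f x * g x)"
proof (induction k arbitrary: f g)
  case 0
  then show ?case by (auto intro: continuous_intros)
next
  case (Suc k)
  from Suc.prems obtain D E where
    D: "\<And>p. p \<in> S \<Longrightarrow> (f has_derivative D p) (at p within S)" "\<And>b. b\<in>Basis \<Longrightarrow> Ck_on k S (\<lambda>p. D p b)" and
    E: "\<And>p. p \<in> S \<Longrightarrow> (g has_derivative E p) (at p within S)" "\<And>b. b\<in>Basis \<Longrightarrow> Ck_on k S (\<lambda>p. E p b)"
    unfolding Ck_on.simps by metis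
  \<comment> \<open>The product rule leaves one factor undifferentiated, so both factors are needed
    at order k as well.\<close>
  have "Ck_on k S f" "Ck_on k S g"
    using Suc.prems Ck_on_Suc_D by blast+
  then show ?case using D E
    by (auto intro!: exI[of _ "\<lambda>p h. f p * E p h + D p h * g p"] derivative_intros Suc.IH Ck_on_add)
qed

text \<open>The derivative is again a function of the same affine form times the constant
  \<open>l \<bullet> b\<close>, so the induction on k closes. With \<open>l\<close> a coordinate
  vector this lifts functions of x or of t alone to the plane.\<close>

lemma Ck_on_affine:
  fixes f :: "real \<Rightarrow> real" and l :: "'a::euclidean_space"
  shows "Ck_on k UNIV f \<Longrightarrow> Ck_on k UNIV (\<lambda>p. f (l \<bullet> p + c))"
proof (induction k arbitrary: f)
  case 0
  then show ?case
    by (auto intro!: continuous_intros continuous_on_compose2[of UNIV f])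
next
  case (Suc k)
  from Suc.prems obtain D where
    D: "\<And>p. (f has_derivative D p) (at p)" "Ck_on k UNIV (\<lambda>p. D p 1)"
    by auto
  have eq: "D p h = h * D p 1" for p h
    using linear_scale[OF has_derivative_linear[OF D(1)], of p h 1] by simp
  have "((\<lambda>p. f (l \<bullet> p + c)) has_derivative (\<lambda>h. D (l \<bullet> p + c) (l \<bullet> h))) (at p)" for p
  proof -
    have "((\<lambda>p. l \<bullet> p + c) has_derivative (\<lambda>h. l \<bullet> h)) (at p)"
      by (auto intro!: derivative_eq_intros)
    from has_derivative_compose[OF this D(1)] show ?thesis .
  qed
  moreover have "Ck_on k UNIV (\<lambda>p. D (l \<bullet> p + c) (l \<bullet> b))" for b
    by (subst eq) (intro Ck_on_mult Ck_on_const Suc.IH D)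
  ultimately show ?case
    by (auto intro!: exI[of _ "\<lambda>p h. D (l \<bullet> p + c) (l \<bullet> h)"])
qed

lemma smooth_on_const: "smooth_on S (\<lambda>_. c)"
  by (simp add: smooth_on_def Ck_on_const)
lemma smooth_on_add: "smooth_on S f \<Longrightarrow> smooth_on S g \<Longrightarrow> smooth_on S (\<lambda>x. f x + g x)"
  by (simp add: smooth_on_def Ck_on_add)
lemma smooth_on_mult: "smooth_on S f \<Longrightarrow> smooth_on S g \<Longrightarrow> smooth_on S (\<lambda>x. f x * g x)"
  by (simp add: smooth_on_def Ck_on_mult)
lemma smooth_on_affine:
  fixes f :: "real \<Rightarrow> real" and l :: "'a::euclidean_space"
  shows "smooth_on UNIV f \<Longrightarrow> smooth_on UNIV (\<lambda>p. f (l \<bullet> p + c))"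
  by (simp add: smooth_on_def Ck_on_affine)

lemma smooth_on_diff:
  assumes "smooth_on S f" "smooth_on S g" shows "smooth_on S (\<lambda>x. f x - g x)"
  using smooth_on_add[OF assms(1) smooth_on_mult[OF smooth_on_const[of S "-1"] assms(2)]] by simp

lemma smooth_on_primitive:
  fixes f :: "real \<Rightarrow> real"
  assumes "\<And>x. (F has_real_derivative f x) (at x)" "smooth_on UNIV f"
  shows "smooth_on UNIV F"
  unfolding smooth_on_def
proof
  fix k
  show "Ck_on k UNIV F"
  proof (cases k)
    case 0
    then show ?thesis using assms(1)
      by (auto intro!: DERIV_continuous_on[of UNIV F])
  next
    case (Suc j)
    then show ?thesis
      using assms by (auto simp: smooth_on_def has_field_derivative_def intro!: exI[of _ "\<lambda>x h. f x * h"])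
  qed
qed

lemma smooth_on_deriv:
  fixes f :: "real \<Rightarrow> real"
  assumes "smooth_on UNIV f"
  shows "(f has_real_derivative deriv f x) (at x)" "smooth_on UNIV (deriv f)"
proof -
  have *: "(f has_real_derivative deriv f x) (at x) \<and> Ck_on k UNIV (deriv f)" for k x
  proof -
    have "Ck_on (Suc k) UNIV f" using assms by (simp only: smooth_on_def)
    then obtain D where D: "\<And>p. (f has_derivative D p) (at p)" "Ck_on k UNIV (\<lambda>p. D p 1)"
      by auto
    have "D p h = D p 1 * h" for p h
      using linear_scale[OF has_derivative_linear[OF D(1)], of p h 1] by simp
    then have "D p = (\<lambda>h. D p 1 * h)" for p by (rule ext)
    then have "(f has_real_derivative D p 1) (at p)" for p
      using D(1)[of p] unfolding has_field_derivative_def by metis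
    moreover from this have "deriv f = (\<lambda>p. D p 1)"
      by (intro ext DERIV_imp_deriv)
    ultimately show ?thesis using D(2) by simp
  qed
  show "(f has_real_derivative deriv f x) (at x)" using * by blast
  show "smooth_on UNIV (deriv f)" using * by (simp add: smooth_on_def)
qed

text \<open>The classical function exp(-1/x), flat at 0, with a polynomial factor in 1/x: the
  polynomial makes the family closed under differentiation.\<close>

definition flat_exp :: "real poly \<Rightarrow> real \<Rightarrow> real" where
  "flat_exp p x = (if x > 0 then poly p (1 / x) * exp (- (1 / x)) else 0)"

lemma poly_exp_tendsto_0: "((\<lambda>y. poly p y * exp (- y)) \<longlongrightarrow> (0::real)) at_top"
proof -
  have "((\<lambda>y. \<Sum>i\<le>degree p. coeff p i * (y ^ i / exp y)) \<longlongrightarrow> (\<Sum>i\<le>degree p. coeff p i * 0)) at_top"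
    by (intro tendsto_sum tendsto_mult[OF tendsto_const tendsto_power_div_exp_0])
  moreover have "(\<Sum>i\<le>degree p. coeff p i * (y ^ i / exp y)) = poly p y * exp (- y)" for y
    unfolding poly_altdef exp_minus sum_distrib_right divide_inverse mult.assoc ..
  ultimately show ?thesis by simp
qed

text \<open>With y = 1/x one has y' = -y^2, so p(y) exp(-y) has derivative y^2 (p(y) - p'(y))
  exp(-y); the factor \<open>[:0,0,1:]\<close> is y^2. At 0 both one-sided difference quotients tend
  to 0.\<close>

lemma flat_exp_DERIV:
  "(flat_exp p has_real_derivative flat_exp ([:0,0,1:] * (p - pderiv p)) x) (at x)"
proof -
  consider "x > 0" | "x < 0" | "x = 0" by linarith
  then show ?thesis
  proof cases
    case 1
    have i: "((\<lambda>x. 1 / x) has_real_derivative - (1 / x\<^sup>2)) (at x)"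
      using 1 by (auto intro!: derivative_eq_intros simp: power2_eq_square)
    have "((\<lambda>x. poly p (1 / x) * exp (- (1 / x))) has_real_derivative
        poly (pderiv p) (1 / x) * (- (1 / x\<^sup>2)) * exp (- (1 / x)) + exp (- (1 / x)) * (- (- (1 / x\<^sup>2))) * poly p (1 / x)) (at x)"
      by (rule DERIV_mult[OF DERIV_chain2[OF poly_DERIV i] DERIV_chain2[OF DERIV_exp DERIV_minus[OF i]]])
    also have "poly (pderiv p) (1 / x) * (- (1 / x\<^sup>2)) * exp (- (1 / x)) + exp (- (1 / x)) * (- (- (1 / x\<^sup>2))) * poly p (1 / x)
       = (1 / x\<^sup>2) * (poly p (1 / x) - poly (pderiv p) (1 / x)) * exp (- (1 / x))"
      by (simp only: algebra_simps)
    also have "\<dots> = flat_exp ([:0,0,1:] * (p - pderiv p)) x"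
      using 1 by (simp add: flat_exp_def power2_eq_square)
    finally have "((\<lambda>x. poly p (1 / x) * exp (- (1 / x))) has_real_derivative
        flat_exp ([:0,0,1:] * (p - pderiv p)) x) (at x)" .
    then show ?thesis
      by (rule has_field_derivative_transform_within_open[of _ _ _ "{0<..}"])
         (use 1 in \<open>auto simp: flat_exp_def\<close>)
  next
    case 2
    show ?thesis
      by (rule has_field_derivative_transform_within_open[of "\<lambda>_. 0" _ _ "{..<0}"])
         (use 2 in \<open>auto simp: flat_exp_def\<close>)
  next
    case 3
    \<comment> \<open>Dividing by h multiplies by y = 1/h, hence the polynomial y p(y); exponential
      decay beats it as y tends to infinity.\<close>
    have "((\<lambda>h::real. poly ([:0,1:] * p) (inverse h) * exp (- inverse h)) \<longlongrightarrow> 0) (at_right 0)"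
      by (rule filterlim_compose[OF poly_exp_tendsto_0 filterlim_inverse_at_top_right])
    moreover have "poly ([:0,1:] * p) (inverse h) * exp (- inverse h) = flat_exp p h / h" if "0 < h" for h
      using that unfolding flat_exp_def inverse_eq_divide by simp
    then have "\<forall>\<^sub>F h in at_right 0. poly ([:0,1:] * p) (inverse h) * exp (- inverse h) = flat_exp p h / h"
      by (intro eventually_mono[OF eventually_at_right_less[of 0]])
    ultimately have r: "((\<lambda>h. flat_exp p h / h) \<longlongrightarrow> 0) (at_right 0)"
      by (rule Lim_transform_eventually)
    have "flat_exp p h / h = 0" if "h < 0" for h using that unfolding flat_exp_def by simp
    then have "\<forall>\<^sub>F h in at_left 0. flat_exp p h / h = 0"
      unfolding eventually_at_filter by simp
    then have l: "((\<lambda>h. flat_exp p h / h) \<longlongrightarrow> 0) (at_left 0)"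
      by (rule tendsto_eventually)
    have "((\<lambda>h. flat_exp p h / h) \<longlongrightarrow> 0) (at 0)"
      using l r by (rule filterlim_split_at)
    moreover have "flat_exp ([:0,0,1:] * (p - pderiv p)) 0 = 0" "flat_exp p 0 = 0" by (simp_all add: flat_exp_def)
    ultimately show ?thesis unfolding DERIV_def 3 by simp
  qed
qed

lemma smooth_flat_exp: "smooth_on UNIV (flat_exp p)"
proof -
  have "Ck_on k UNIV (flat_exp p)" for k
  proof (induction k arbitrary: p)
    case 0
    show ?case unfolding Ck_on.simps(1) by (rule DERIV_continuous_on[OF flat_exp_DERIV])
  next
    case (Suc k)
    define q where "q = [:0,0,1:] * (p - pderiv p)"
    have "\<forall>x\<in>UNIV. (flat_exp p has_derivative (\<lambda>h. flat_exp q x * h)) (at x within UNIV)"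
      using flat_exp_DERIV[of p] by (intro ballI) (simp only: q_def has_field_derivative_def)
    moreover have "\<forall>b\<in>Basis. Ck_on k UNIV (\<lambda>x. flat_exp q x * b)"
      by (intro ballI Ck_on_mult Ck_on_const Suc)
    ultimately show ?case unfolding Ck_on.simps(2)
      by (intro exI[of _ "\<lambda>x h. flat_exp q x * h"] conjI)
  qed
  then show ?thesis by (simp add: smooth_on_def)
qed

section \<open>Primitives, smooth steps and smooth ramps\<close>

lemma antiderivative_exists:
  fixes f :: "real \<Rightarrow> real"
  assumes "continuous_on UNIV f"
  obtains F where "\<And>x. (F has_real_derivative f x) (at x)" "F 0 = 0"
proof
  fix x
  \<comment> \<open>The interval is chosen to contain 0 and to have x in its interior, so that the
    derivative within it is the full derivative.\<close>
  have "((\<lambda>u. LBINT y=0..u. f y) has_vector_derivative f x) (at x within {-\<bar>x\<bar>-1..\<bar>x\<bar>+1})"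
    unfolding zero_ereal_def by (rule interval_integral_FTC2) (auto intro: continuous_on_subset[OF assms])
  then have "((\<lambda>u. LBINT y=0..u. f y) has_vector_derivative f x) (at x)"
    by (subst (asm) at_within_interior) auto
  then show "((\<lambda>u. LBINT y=0..u. f y) has_real_derivative f x) (at x)"
    by (simp add: has_real_derivative_iff_has_vector_derivative)
qed (simp add: zero_ereal_def[symmetric])

lemma DERIV_const_eq:
  fixes F :: "real \<Rightarrow> real"
  assumes "\<And>x. (F has_real_derivative f x) (at x)" "a \<le> b" "\<And>x. a < x \<Longrightarrow> x < b \<Longrightarrow> f x = 0"
  shows "F b = F a"
proof (cases "a = b")
  case False
  show ?thesis
  proof (rule DERIV_isconst_end[of a b F])
    show "continuous_on {a..b} F"
      using assms(1) by (meson DERIV_continuous_on DERIV_subset subset_UNIV)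
    show "(F has_real_derivative 0) (at x)" if "a < x" "x < b" for x
      using assms(1)[of x] assms(3) that by simp
  qed (use False assms in auto)
qed auto

text \<open>Take the normalised primitive of the bump
  \<open>flat_exp 1 x * flat_exp 1 (1 - x)\<close>, which is positive exactly on (0, 1).\<close>

lemma smooth_step_exists:
  obtains S :: "real \<Rightarrow> real" where "smooth_on UNIV S" "\<And>x. x \<le> 0 \<Longrightarrow> S x = 0"
    "\<And>x. x \<ge> 1 \<Longrightarrow> S x = 1" "\<And>x. 0 \<le> S x" "\<And>x. S x \<le> 1"
proof -
  define f where "f x = flat_exp 1 x * flat_exp 1 (1 - x)" for x
  have sf: "smooth_on UNIV f"
    unfolding f_def using smooth_on_mult[OF smooth_flat_exp smooth_on_affine[OF smooth_flat_exp[of 1], of "-1::real" 1], of 1]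
    by simp
  have f0: "f x \<ge> 0" for x by (simp add: f_def flat_exp_def)
  have fpos: "f x > 0" if "0 < x" "x < 1" for x using that by (simp add: f_def flat_exp_def)
  have fz: "f x = 0" if "x \<le> 0 \<or> x \<ge> 1" for x using that by (auto simp: f_def flat_exp_def)
  have "continuous_on UNIV f"
    using sf Ck_on_continuous unfolding smooth_on_def by blast
  then obtain P where P: "\<And>x. (P has_real_derivative f x) (at x)" "P 0 = 0"
    using antiderivative_exists by blast
  have Pz: "P x = 0" if "x \<le> 0" for x
    using DERIV_const_eq[OF P(1) that] P(2) fz by simp
  have Pc: "P x = P 1" if "x \<ge> 1" for x
    using DERIV_const_eq[OF P(1) that] fz by simp
  have mono: "P x \<le> P y" if "x \<le> y" for x y
    using that P(1) f0 by (meson DERIV_nonneg_imp_nondecreasing)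
  have "P 0 < P 1"
  proof (rule DERIV_pos_imp_increasing_open[of 0 1 P])
    show "continuous_on {0..1} P" using P(1) by (meson DERIV_continuous_on DERIV_subset subset_UNIV)
  qed (use P fpos in auto)
  then have P1: "P 1 > 0" using P(2) by simp
  show ?thesis
  proof (rule that[of "\<lambda>x. P x * (1 / P 1)"])
    show "smooth_on UNIV (\<lambda>x. P x * (1 / P 1))"
      by (intro smooth_on_mult smooth_on_const smooth_on_primitive[OF P(1) sf])
    show "P x * (1 / P 1) = 0" if "x \<le> 0" for x using Pz that by simp
    show "P x * (1 / P 1) = 1" if "x \<ge> 1" for x using Pc[OF that] P1 by simp
    show "0 \<le> P x * (1 / P 1)" for x
      using mono[of 0 x] Pz[of 0] Pz[of x] P1 by (cases "x \<le> 0") auto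
    show "P x * (1 / P 1) \<le> 1" for x
      using mono[of x 1] Pc[of x] P1 by (cases "x \<le> 1") auto
  qed
qed

text \<open>The du Bois-Reymond lemma prescribes the derivative of a test function. Where that
  derivative is a combination of steps, the test function itself is a combination of ramps, so the
  ramp has to be known explicitly on both sides of the transition.\<close>

lemma smooth_ramp_exists:
  obtains S T :: "real \<Rightarrow> real" where "smooth_on UNIV T" "\<And>x. (T has_real_derivative S x) (at x)"
    "\<And>x. x \<le> 0 \<Longrightarrow> S x = 0" "\<And>x. x \<ge> 1 \<Longrightarrow> S x = 1" "\<And>x. 0 \<le> S x" "\<And>x. S x \<le> 1"
    "\<And>x. x \<le> 0 \<Longrightarrow> T x = 0" "\<And>x. x \<ge> 1 \<Longrightarrow> T x = T 1 + (x - 1)" "continuous_on UNIV S"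
proof -
  obtain S :: "real \<Rightarrow> real" where S: "smooth_on UNIV S" "\<And>x. x \<le> 0 \<Longrightarrow> S x = 0"
    "\<And>x. x \<ge> 1 \<Longrightarrow> S x = 1" "\<And>x. 0 \<le> S x" "\<And>x. S x \<le> 1"
    by (rule smooth_step_exists) blast
  have cS: "continuous_on UNIV S"
    using S(1) Ck_on_continuous unfolding smooth_on_def by blast
  then obtain T where T: "\<And>x. (T has_real_derivative S x) (at x)" "T 0 = 0"
    using antiderivative_exists by blast
  show ?thesis
  proof (rule that[of T S])
    show "smooth_on UNIV T" by (rule smooth_on_primitive[OF T(1) S(1)])
    show "T x = 0" if "x \<le> 0" for x
      using DERIV_const_eq[OF T(1) that] T(2) S by simp
    have "((\<lambda>x. T x - x) has_real_derivative S x - 1) (at x)" for x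
      by (auto intro!: derivative_eq_intros T)
    from DERIV_const_eq[OF this, of 1]
    show "T x = T 1 + (x - 1)" if "x \<ge> 1" for x
      using that S(3) by force
  qed (use S T cS in auto)
qed

section \<open>Integration by parts and the du Bois-Reymond lemma\<close>

text \<open>This class is stable under sums and products, and its members are integrable over
  bounded intervals; it replaces integrability conditions throughout.\<close>

definition loc_bounded :: "(real \<Rightarrow> real) \<Rightarrow> bool" where
  "loc_bounded Z \<longleftrightarrow> Z \<in> borel_measurable borel \<and> (\<forall>c d. \<exists>B. \<forall>x\<in>{c..d}. \<bar>Z x\<bar> \<le> B)"

lemma loc_boundedE:
  assumes "loc_bounded Z"
  obtains B where "B \<ge> 0" "\<And>x. x \<in> {c..d} \<Longrightarrow> \<bar>Z x\<bar> \<le> B"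
proof -
  obtain B where "\<And>x. x \<in> {c..d} \<Longrightarrow> \<bar>Z x\<bar> \<le> B"
    using assms unfolding loc_bounded_def by blast
  then have "\<bar>B\<bar> \<ge> 0" "\<And>x. x \<in> {c..d} \<Longrightarrow> \<bar>Z x\<bar> \<le> \<bar>B\<bar>" by force+
  then show ?thesis by (rule that)
qed

lemma integrable_bounded_cbox:
  fixes h :: "'a::euclidean_space \<Rightarrow> real"
  assumes "h \<in> borel_measurable borel" "\<And>p. p \<in> cbox a b \<Longrightarrow> \<bar>h p\<bar> \<le> B" "\<And>p. p \<notin> cbox a b \<Longrightarrow> h p = 0"
  shows "integrable lborel h"
proof (rule integrableI_bounded_set[where A="cbox a b" and B=B])
  show "emeasure lborel (cbox a b) < \<infinity>"
    by (simp add: emeasure_lborel_cbox_eq)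
qed (use assms in auto)

lemma loc_bounded_set_integrable:
  assumes "loc_bounded Z"
  shows "set_integrable lborel {c..d} Z"
proof -
  obtain B where B: "\<And>x. x \<in> {c..d} \<Longrightarrow> \<bar>Z x\<bar> \<le> B" using loc_boundedE[OF assms] by metis
  show ?thesis unfolding set_integrable_def
    by (rule integrable_bounded_cbox[where a=c and b=d and B=B])
       (use assms B in \<open>auto simp: loc_bounded_def\<close>)
qed

lemma loc_bounded_interval_integrable:
  assumes "loc_bounded Z"
  shows "interval_lebesgue_integrable lborel (ereal c) (ereal d) Z"
  unfolding interval_lebesgue_integrable_def
  by (auto intro: set_integrable_subset[OF loc_bounded_set_integrable[OF assms, of c d]]
        set_integrable_subset[OF loc_bounded_set_integrable[OF assms, of d c]])

lemma loc_bounded_continuous: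
  assumes "continuous_on UNIV Z" shows "loc_bounded Z"
  unfolding loc_bounded_def
proof safe
  show "Z \<in> borel_measurable borel" using assms by (rule borel_measurable_continuous_onI)
  fix c d
  have "bounded (Z ` {c..d})"
    by (intro compact_imp_bounded compact_continuous_image continuous_on_subset[OF assms]) auto
  then show "\<exists>B. \<forall>x\<in>{c..d}. \<bar>Z x\<bar> \<le> B" by (auto simp: bounded_iff)
qed

lemma loc_bounded_add: assumes "loc_bounded f" "loc_bounded g" shows "loc_bounded (\<lambda>x. f x + g x)"
  unfolding loc_bounded_def
proof safe
  show "(\<lambda>x. f x + g x) \<in> borel_measurable borel" using assms by (auto simp: loc_bounded_def)
  fix c d
  obtain B C where "\<And>x. x \<in> {c..d} \<Longrightarrow> \<bar>f x\<bar> \<le> B" "\<And>x. x \<in> {c..d} \<Longrightarrow> \<bar>g x\<bar> \<le> C"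
    using loc_boundedE[OF assms(1)] loc_boundedE[OF assms(2)] by metis
  then show "\<exists>B. \<forall>x\<in>{c..d}. \<bar>f x + g x\<bar> \<le> B"
    by (intro exI[of _ "B+C"]) force
qed

lemma loc_bounded_mult: assumes "loc_bounded f" "loc_bounded g" shows "loc_bounded (\<lambda>x. f x * g x)"
  unfolding loc_bounded_def
proof safe
  show "(\<lambda>x. f x * g x) \<in> borel_measurable borel" using assms by (auto simp: loc_bounded_def)
  fix c d
  obtain B C where "B \<ge> 0" "\<And>x. x \<in> {c..d} \<Longrightarrow> \<bar>f x\<bar> \<le> B" "\<And>x. x \<in> {c..d} \<Longrightarrow> \<bar>g x\<bar> \<le> C"
    using loc_boundedE[OF assms(1)] loc_boundedE[OF assms(2)] by metis
  then show "\<exists>B. \<forall>x\<in>{c..d}. \<bar>f x * g x\<bar> \<le> B"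
    by (intro exI[of _ "B*C"]) (auto simp: abs_mult intro!: mult_mono)
qed

lemma loc_bounded_diff: assumes "loc_bounded f" "loc_bounded g" shows "loc_bounded (\<lambda>x. f x - g x)"
  using loc_bounded_add[OF assms(1) loc_bounded_mult[OF loc_bounded_continuous[OF continuous_on_const, of "-1"] assms(2)]] by simp

text \<open>The function (s - r) 1_(p,q] - (q - p) 1_(r,s] has integral 0, so its primitive has
  compact support. Smoothing that primitive gives admissible test functions, and the limit of the
  tested identities is the claim. Since only means are compared, Z need not be continuous. The bound
  l keeps supports inside an open half line, which the time variable requires.\<close>

lemma du_bois_reymond:
  fixes Z :: "real \<Rightarrow> real" and l p q r s :: real
  assumes Z: "loc_bounded Z"
    and test: "\<And>a c d. smooth_on UNIV a \<Longrightarrow> l < c \<Longrightarrow> (\<And>x. x \<notin> {c..d} \<Longrightarrow> a x = 0) \<Longrightarrow>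
        (LINT x|lborel. Z x * deriv a x) = 0"
    and "l < p" "p \<le> q" "l < r" "r \<le> s"
  shows "(s - r) * (LBINT x=p..q. Z x) = (q - p) * (LBINT x=r..s. Z x)"
proof -
  obtain S T :: "real \<Rightarrow> real" where T: "smooth_on UNIV T" "\<And>x. (T has_real_derivative S x) (at x)"
    and S: "\<And>x. x \<le> 0 \<Longrightarrow> S x = 0" "\<And>x. x \<ge> 1 \<Longrightarrow> S x = 1" "\<And>x. 0 \<le> S x" "\<And>x. S x \<le> 1"
    and T0: "\<And>x. x \<le> 0 \<Longrightarrow> T x = 0" and T1: "\<And>x. x \<ge> 1 \<Longrightarrow> T x = T 1 + (x - 1)"
    and cS: "continuous_on UNIV S"
    using smooth_ramp_exists by metis
  \<comment> \<open>\<open>Sn n c\<close> rises from 0 to 1 on an interval of length 1/(n+1) to the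
    right of c, and \<open>Tn n c\<close> is its primitive vanishing up to c.\<close>
  define Sn where "Sn n c x = S (real (Suc n) * (x - c))" for n c x
  define Tn where "Tn n c x = T (real (Suc n) * x + (- real (Suc n) * c)) * (1 / real (Suc n))" for n c x
  define an where "an n x = (s - r) * (Tn n p x - Tn n q x) - (q - p) * (Tn n r x - Tn n s x)" for n x
  define dn where "dn n x = (s - r) * (Sn n p x - Sn n q x) - (q - p) * (Sn n r x - Sn n s x)" for n x
  define lim where "lim x = (s - r) * indicator {p<..q} x - (q - p) * indicator {r<..s} x" for x :: real
  \<comment> \<open>One support interval for all n; the extra 1 accommodates the widest transition,
    that of n = 0.\<close>
  define c d where "c = min p r" and "d = max q s + 1"
  have sm: "smooth_on UNIV (an n)" for n
  proof -
    have "smooth_on UNIV (Tn n c)" for c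
      unfolding Tn_def using smooth_on_affine[OF T(1), of "real (Suc n)" "- real (Suc n) * c"]
      by (intro smooth_on_mult smooth_on_const) simp
    then show ?thesis unfolding an_def
      by (intro smooth_on_diff smooth_on_mult smooth_on_const)
  qed
  have der: "deriv (an n) x = dn n x" for n x
  proof -
    have "(Tn n c has_real_derivative Sn n c x) (at x)" for c
    proof -
      have "((\<lambda>x. real (Suc n) * x + (- real (Suc n) * c)) has_real_derivative real (Suc n)) (at x)"
        by (auto intro!: derivative_eq_intros)
      from DERIV_cmult_right[OF DERIV_chain2[OF T(2) this], of "1 / real (Suc n)"]
      have "(Tn n c has_real_derivative S (real (Suc n) * x + (- real (Suc n) * c)) * real (Suc n) * (1 / real (Suc n))) (at x)"
        unfolding Tn_def .
      then show ?thesis by (simp add: Sn_def right_diff_distrib del: of_nat_Suc)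
    qed
    then have "(an n has_real_derivative dn n x) (at x)"
      unfolding an_def dn_def by (intro DERIV_diff DERIV_cmult)
    then show ?thesis by (rule DERIV_imp_deriv)
  qed
  have Tz: "Tn n c x = 0" if "x \<le> c" for n c x
    using that T0 by (auto simp: Tn_def right_diff_distrib[symmetric] mult_nonneg_nonpos simp del: of_nat_Suc
        intro!: T0 mult_nonneg_nonpos)
  have Tl: "Tn n c x = (T 1 - 1) / real (Suc n) + (x - c)" if "x \<ge> c + 1" for n c x
  proof -
    have "real (Suc n) * x + (- real (Suc n) * c) = real (Suc n) * (x - c)" by (simp add: algebra_simps)
    moreover have "real (Suc n) * (x - c) \<ge> 1 * 1" by (rule mult_mono) (use that in auto)
    ultimately show ?thesis using T1[of "real (Suc n) * (x - c)"] by (simp add: Tn_def field_simps)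
  qed
  \<comment> \<open>To the right of all transitions a ramp is x - c plus a constant that does not
    depend on c. The two differences of ramps are then q - p and s - r, and the weighted terms
    cancel.\<close>
  have supp: "an n x = 0" if "x \<notin> {c..d}" for n x
  proof (cases "x < c")
    case True
    then show ?thesis using assms(3-6) by (simp add: an_def c_def Tz)
  next
    case False
    then have "x \<ge> q + 1" "x \<ge> s + 1" "x \<ge> p + 1" "x \<ge> r + 1" using that assms(3-6) by (auto simp: d_def)
    then show ?thesis by (simp add: an_def Tl algebra_simps)
  qed
  have z: "(LINT x|lborel. Z x * dn n x) = 0" for n
    using test[OF sm, of c d n] supp assms(3-6) by (simp add: der c_def)
  have dz: "dn n x = 0" if "x \<notin> {c..d}" for n x
  proof (cases "x < c")
    case True
    then have "x \<le> p" "x \<le> q" "x \<le> r" "x \<le> s" using assms(3-6) by (auto simp: c_def)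
    then have "Sn n p x = 0" "Sn n q x = 0" "Sn n r x = 0" "Sn n s x = 0"
      by (auto simp: Sn_def intro!: S(1) mult_nonneg_nonpos simp del: of_nat_Suc)
    then show ?thesis by (simp add: dn_def)
  next
    case False
    then have "x \<ge> q + 1" "x \<ge> s + 1" "x \<ge> p + 1" "x \<ge> r + 1" using that assms(3-6) by (auto simp: d_def)
    then have "Sn n y x = 1" if "y \<in> {p,q,r,s}" for y
      using that mult_mono[of 1 "real (Suc n)" 1 "x - y"] by (auto simp: Sn_def intro!: S(2))
    then show ?thesis by (simp add: dn_def)
  qed
  obtain B where B: "B \<ge> 0" "\<And>x. x \<in> {c..d} \<Longrightarrow> \<bar>Z x\<bar> \<le> B" using loc_boundedE[OF Z] by metis
  define C where "C = (s - r) * 1 + (q - p) * 1"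
  have dC: "\<bar>dn n x\<bar> \<le> C" for n x
  proof -
    have *: "\<bar>Sn n y x - Sn n z x\<bar> \<le> 1" for y z
      using S(3)[of "real (Suc n) * (x - y)"] S(4)[of "real (Suc n) * (x - y)"]
       S(3)[of "real (Suc n) * (x - z)"] S(4)[of "real (Suc n) * (x - z)"] unfolding Sn_def by linarith
    have "\<bar>dn n x\<bar> \<le> \<bar>(s - r) * (Sn n p x - Sn n q x)\<bar> + \<bar>(q - p) * (Sn n r x - Sn n s x)\<bar>"
      unfolding dn_def by linarith
    also have "\<dots> \<le> C" unfolding C_def abs_mult
      by (intro add_mono mult_mono) (use assms(3-6) * in auto)
    finally show ?thesis .
  qed
  have Zm[measurable]: "Z \<in> borel_measurable borel" using Z by (simp add: loc_bounded_def)
  have Sm[measurable]: "S \<in> borel_measurable borel" using cS by (rule borel_measurable_continuous_onI)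
  have "(\<lambda>n. LINT x|lborel. Z x * dn n x) \<longlonglongrightarrow> (LINT x|lborel. Z x * lim x)"
  proof (rule integral_dominated_convergence[where w="\<lambda>x. indicator {c..d} x * (B * C)"])
    show "integrable lborel (\<lambda>x. indicator {c..d} x * (B * C))"
      by (rule integrable_bounded_cbox[where a=c and b=d and B="B*C"])
         (use B(1) dC[of 0 0] in \<open>auto simp: indicator_def\<close>)
    show "AE x in lborel. norm (Z x * dn n x) \<le> indicator {c..d} x * (B * C)" for n
      using B dC[of n] dz[of _ n] by (auto simp: indicator_def abs_mult intro!: AE_I2 mult_mono)
    show "AE x in lborel. (\<lambda>n. Z x * dn n x) \<longlonglongrightarrow> Z x * lim x"
    proof (rule AE_I2)
      fix x
      \<comment> \<open>At x = y the value is S 0 = 0 for every n, so the limiting intervals are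
        open on the left.\<close>
      have "(\<lambda>n. Sn n y x) \<longlonglongrightarrow> (if x > y then 1 else 0)" for y
      proof (cases "x > y")
        case True
        then obtain N where N: "1 / (x - y) < real N" using reals_Archimedean2 by blast
        have "\<forall>\<^sub>F n in sequentially. Sn n y x = 1"
          using eventually_ge_at_top[of N]
        proof eventually_elim
          case (elim n)
          have "1 / (x - y) \<le> real (Suc n)" using N elim by simp
          then show ?case using True by (auto simp: Sn_def field_simps intro!: S(2))
        qed
        then show ?thesis using True by (simp add: tendsto_eventually)
      next
        case False
        then have "Sn n y x = 0" for n
          by (auto simp: Sn_def intro!: S(1) mult_nonneg_nonpos simp del: of_nat_Suc)
        then show ?thesis using False by simp
      qed
      then have "(\<lambda>n. Z x * dn n x) \<longlonglongrightarrow> Z x * ((s - r) * ((if x > p then 1 else 0) - (if x > q then 1 else 0)) -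
         (q - p) * ((if x > r then 1 else 0) - (if x > s then 1 else 0)))"
        unfolding dn_def by (intro tendsto_intros)
      also have "((s - r) * ((if x > p then 1 else 0) - (if x > q then 1 else 0)) -
         (q - p) * ((if x > r then 1 else 0) - (if x > s then 1 else 0))) = lim x"
        using assms(3-6) by (auto simp: lim_def indicator_def)
      finally show "(\<lambda>n. Z x * dn n x) \<longlonglongrightarrow> Z x * lim x" .
    qed
  qed (auto simp: dn_def lim_def Sn_def)
  then have "(LINT x|lborel. Z x * lim x) = 0"
    by (simp add: z LIMSEQ_const_iff)
  moreover have "Z x * lim x = (s - r) * (indicator {p<..q} x *\<^sub>R Z x) - (q - p) * (indicator {r<..s} x *\<^sub>R Z x)" for x
    by (simp add: lim_def algebra_simps)
  moreover have "set_integrable lborel {a<..b} Z" for a b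
    by (rule set_integrable_subset[OF loc_bounded_set_integrable[OF Z, of a b]]) auto
  ultimately show ?thesis
    using assms(3-6)
    by (simp add: interval_integral_Ioc set_lebesgue_integral_def set_integrable_def)
qed

section \<open>Interval integrals and integration by parts against primitives\<close>

lemma primitive_diff:
  fixes c x y :: real
  assumes "loc_bounded w"
  shows "(LBINT z=c..y. w z) - (LBINT z=c..x. w z) = (LBINT z=x..y. w z)"
proof -
  have "interval_lebesgue_integrable lborel (min (ereal c) (min (ereal x) (ereal y))) (max (ereal c) (max (ereal x) (ereal y))) w"
    unfolding ereal_min[symmetric] ereal_max[symmetric] by (rule loc_bounded_interval_integrable[OF assms])
  from interval_integral_sum[OF this] show ?thesis by simp
qed

lemma interval_integral_bound:
  fixes w :: "real \<Rightarrow> real"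
  assumes "x \<le> y" "\<And>z. x < z \<Longrightarrow> z < y \<Longrightarrow> \<bar>w z\<bar> \<le> B" "0 \<le> B"
  shows "\<bar>LBINT z=x..y. w z\<bar> \<le> B * (y - x)"
proof -
  have I: "integrable lborel (\<lambda>z. indicator {x<..<y} z * B)"
    by (rule integrable_bounded_cbox[where a=x and b=y and B=B]) (use assms(3) in \<open>auto simp: indicator_def\<close>)
  have "\<bar>LINT z:{x<..<y}|lborel. w z\<bar> \<le> (LINT z|lborel. \<bar>indicator {x<..<y} z *\<^sub>R w z\<bar>)"
    unfolding set_lebesgue_integral_def real_norm_def[symmetric] by (rule integral_norm_bound)
  also have "\<dots> \<le> (LINT z|lborel. indicator {x<..<y} z * B)"
    by (rule integral_mono'[OF I]) (use assms in \<open>auto simp: indicator_def\<close>)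
  finally have "\<bar>LINT z:{x<..<y}|lborel. w z\<bar> \<le> (LINT z|lborel. indicator {x<..<y} z * B)" .
  then show ?thesis using assms by (simp add: interval_lebesgue_integral_def mult.commute)
qed

lemma interval_integral_const:
  fixes p q :: real
  shows "(LBINT x=p..q. k) = (q - p) * k"
  using interval_integral_FTC_finite[of p q "\<lambda>_. k" "\<lambda>y. y * k"]
  by (auto intro!: derivative_eq_intros simp: algebra_simps has_real_derivative_iff_has_vector_derivative[symmetric])

lemma interval_integral_mono:
  fixes f g :: "real \<Rightarrow> real" and x y :: real
  assumes "loc_bounded f" "loc_bounded g" "AE z in lborel. f z \<le> g z" "x \<le> y"
  shows "(LBINT z=x..y. f z) \<le> (LBINT z=x..y. g z)"
  unfolding interval_integral_Icc[OF assms(4)] set_lebesgue_integral_def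
  by (rule integral_mono_AE)
     (use loc_bounded_set_integrable[OF assms(1)] loc_bounded_set_integrable[OF assms(2)] assms(3) in
       \<open>auto simp: set_integrable_def indicator_def\<close>)

lemma DERIV_zero_outside:
  fixes g :: "real \<Rightarrow> real"
  assumes "\<And>x. (g has_real_derivative g' x) (at x)" "\<And>x. x \<notin> {c..d} \<Longrightarrow> g x = 0" "x \<notin> {c..d}"
  shows "g' x = 0"
proof -
  have "(g has_real_derivative 0) (at x)"
    by (rule has_field_derivative_transform_within_open[of "\<lambda>_. 0" _ _ "- {c..d}"])
       (use assms in auto)
  then show ?thesis using assms(1) DERIV_unique by blast
qed

text \<open>Approach each end from outside the interval, where g vanishes.\<close>

lemma zero_at_ends:
  fixes g :: "real \<Rightarrow> real"
  assumes "continuous_on UNIV g" "\<And>x. x \<notin> {c..d} \<Longrightarrow> g x = 0"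
  shows "g c = 0" "g d = 0"
proof -
  have "((g \<longlongrightarrow> g c) (at_left c))" "((g \<longlongrightarrow> g d) (at_right d))"
    using assms(1) by (auto simp: continuous_on_def intro: tendsto_within_subset)
  moreover have "(g \<longlongrightarrow> 0) (at_left c)" "(g \<longlongrightarrow> 0) (at_right d)"
    by (rule tendsto_eventually, auto simp: eventually_at_filter assms(2))+
  ultimately show "g c = 0" "g d = 0"
    using tendsto_unique[OF trivial_limit_at_left_real[of c], of g "g c" 0]
      tendsto_unique[OF trivial_limit_at_right_real[of d], of g "g d" 0] by simp_all
qed

text \<open>Since w is only locally bounded, P need not be differentiable and no product rule is
  available. Instead w(y) g'(x) is integrated over the triangle c < y \<le> x \<le> d in both
  orders. The hypothesis on P concerns [c, d] only, where g and g' live.\<close>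

lemma integral_by_parts_primitive:
  fixes w P g g' :: "real \<Rightarrow> real"
  assumes w: "loc_bounded w"
    and P: "\<And>x. c \<le> x \<Longrightarrow> x \<le> d \<Longrightarrow> P x - P c = (LBINT z=c..x. w z)"
    and g: "\<And>x. (g has_real_derivative g' x) (at x)" and g': "continuous_on UNIV g'"
    and z: "\<And>x. x \<notin> {c..d} \<Longrightarrow> g x = 0"
  shows "(LINT x|lborel. P x * g' x) = - (LINT x|lborel. w x * g x)"
proof (cases "c \<le> d")
  case False
  then have "g x = 0" "g' x = 0" for x
    using z[of x] DERIV_zero_outside[of g g' c d x, OF g z] by auto
  then show ?thesis by simp
next
  case True
  have cg: "continuous_on UNIV g" using g by (meson DERIV_continuous_on DERIV_subset subset_UNIV)
  have ends: "g c = 0" "g d = 0" using zero_at_ends[OF cg z] by auto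
  have z': "g' x = 0" if "x \<notin> {c..d}" for x using DERIV_zero_outside[of g g' c d x, OF g z that] .
  have [measurable]: "w \<in> borel_measurable borel" "g' \<in> borel_measurable borel" "g \<in> borel_measurable borel"
    using w g' cg by (auto simp: loc_bounded_def intro: borel_measurable_continuous_onI)
  obtain B where B: "B \<ge> 0" "\<And>x. x \<in> {c..d} \<Longrightarrow> \<bar>w x\<bar> \<le> B" using loc_boundedE[OF w] by metis
  obtain C where C: "C \<ge> 0" "\<And>x. x \<in> {c..d} \<Longrightarrow> \<bar>g' x\<bar> \<le> C"
    using loc_boundedE[OF loc_bounded_continuous[OF g']] by metis
  \<comment> \<open>Integrating out y gives (P x - P c) g'(x); integrating out x gives w(y) (g d - g
    y) = - w(y) g(y).\<close>
  define k where "k x y = (if c \<le> x \<and> x \<le> d \<and> c < y \<and> y \<le> x then w y * g' x else 0)" for x y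
  have "case_prod k \<in> borel_measurable (borel \<Otimes>\<^sub>M borel)"
    unfolding k_def case_prod_beta by measurable
  then have km: "case_prod k \<in> borel_measurable (borel :: (real \<times> real) measure)"
    by (simp add: borel_prod)
  have kint: "integrable (lborel \<Otimes>\<^sub>M lborel) (case_prod k)"
    unfolding lborel_prod
  proof (rule integrable_bounded_cbox[where a="(c,c)" and b="(d,d)" and B="B*C"])
    show "\<bar>case_prod k p\<bar> \<le> B * C" for p
      using B C by (auto simp: k_def abs_mult case_prod_beta intro!: mult_mono)
    show "case_prod k p = 0" if "p \<notin> cbox (c,c) (d,d)" for p
      using that by (cases p) (auto simp: k_def cbox_Pair_eq)
  qed (use km in simp)
  have FT: "(LBINT x=a..b. g' x) = g b - g a" for a b
    by (rule interval_integral_FTC_finite)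
       (auto intro: continuous_on_subset[OF g'] has_field_derivative_at_within g
          simp: has_real_derivative_iff_has_vector_derivative[symmetric])
  have inner: "(LINT y|lborel. k x y) = indicator {c..d} x * ((P x - P c) * g' x)" for x
  proof (cases "x \<in> {c..d}")
    case True
    then have "k x y = (indicator {c<..x} y *\<^sub>R w y) * g' x" for y
      by (auto simp: k_def indicator_def)
    then have "(LINT y|lborel. k x y) = (LINT y:{c<..x}|lborel. w y) * g' x"
      by (simp add: set_lebesgue_integral_def)
    then show ?thesis using True P[of x] by (simp add: interval_integral_Ioc)
  qed (auto simp: k_def)
  have outer: "(LINT x|lborel. k x y) = - (w y * g y)" for y
  proof (cases "c < y \<and> y \<le> d")
    case True
    then have "k x y = w y * (indicator {y..d} x *\<^sub>R g' x)" for x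
      by (auto simp: k_def indicator_def)
    then have "(LINT x|lborel. k x y) = w y * (LINT x:{y..d}|lborel. g' x)"
      by (simp add: set_lebesgue_integral_def)
    also have "(LINT x:{y..d}|lborel. g' x) = g d - g y"
      using True FT[of y d] by (simp add: interval_integral_Icc)
    finally show ?thesis by (simp add: ends)
  next
    case False
    then have "k x y = 0" for x by (auto simp: k_def)
    moreover have "g y = 0" using False z[of y] ends by (cases "y = c") auto
    ultimately show ?thesis by simp
  qed
  have i1: "integrable lborel (\<lambda>x. indicator {c..d} x * ((P x - P c) * g' x))"
    using lborel_pair.integrable_fst'[OF kint] by (simp add: inner)
  have i2: "integrable lborel (\<lambda>x. P c * g' x)"
  proof (rule integrable_bounded_cbox[where a=c and b=d and B="\<bar>P c\<bar>*C"])
    show "P c * g' x = 0" if "x \<notin> cbox c d" for x using z'[of x] that by simp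
    show "\<bar>P c * g' x\<bar> \<le> \<bar>P c\<bar> * C" if "x \<in> cbox c d" for x
      using C(2)[of x] that by (simp add: abs_mult mult_left_mono)
  qed simp
  \<comment> \<open>The constant P c contributes nothing, because the integral of g' is g d - g c =
    0.\<close>
  have "(LINT x|lborel. P x * g' x) = (LINT x|lborel. indicator {c..d} x * ((P x - P c) * g' x) + P c * g' x)"
    by (intro Bochner_Integration.integral_cong) (auto simp: indicator_def z' algebra_simps)
  also have "\<dots> = (LINT x|lborel. (LINT y|lborel. k x y)) + P c * (LINT x|lborel. g' x)"
    using i1 i2 by (simp add: inner)
  also have "(LINT x|lborel. g' x) = (LINT x:{c..d}|lborel. g' x)"
    unfolding set_lebesgue_integral_def
  proof (intro Bochner_Integration.integral_cong refl)
    show "g' x = indicator {c..d} x *\<^sub>R g' x" for x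
      using z'[of x] by (cases "x \<in> {c..d}") auto
  qed
  also have "\<dots> = 0" using True FT[of c d] ends by (simp add: interval_integral_Icc)
  also have "(LINT x|lborel. (LINT y|lborel. k x y)) = (LINT y|lborel. (LINT x|lborel. k x y))"
    by (rule lborel_pair.Fubini_integral[OF kint, symmetric])
  finally show ?thesis by (simp add: outer)
qed

text \<open>Means over [p, p+h] and [r, r+h] coincide by the averaged form; as h decreases to 0 they
  tend to the values at p and r.\<close>

lemma du_bois_reymond_continuous:
  fixes Z :: "real \<Rightarrow> real"
  assumes Z: "loc_bounded Z" and c: "continuous_on {l<..} Z"
    and test: "\<And>a c d. smooth_on UNIV a \<Longrightarrow> l < c \<Longrightarrow> (\<And>x. x \<notin> {c..d} \<Longrightarrow> a x = 0) \<Longrightarrow>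
        (LINT x|lborel. Z x * deriv a x) = 0"
    and "l < p" "l < r"
  shows "Z p = Z r"
proof -
  have lim: "((\<lambda>h. (LBINT x=p..p+h. Z x) / h) \<longlongrightarrow> Z p) (at_right 0)" if "l < p" for p
  proof -
    have "((\<lambda>u. LBINT y=p..u. Z y) has_vector_derivative Z p) (at p within {p..p+1})"
      by (rule interval_integral_FTC2) (use that in \<open>auto intro: continuous_on_subset[OF c]\<close>)
    then have "((\<lambda>u. LBINT y=p..u. Z y) has_real_derivative Z p) (at p within {p..p+1})"
      by (simp add: has_real_derivative_iff_has_vector_derivative)
    then have "((\<lambda>u. (LBINT y=p..u. Z y) / (u - p)) \<longlongrightarrow> Z p) (at p within {p..p+1})"
      unfolding has_field_derivative_iff interval_integral_endpoints_same diff_0_right .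
    then have "((\<lambda>u. (LBINT y=p..u. Z y) / (u - p)) \<longlongrightarrow> Z p) (at_right p)"
      by (subst (asm) at_within_Icc_at_right) simp
    then have "((\<lambda>h. (LBINT y=p..(h + p). Z y) / (h + p - p)) \<longlongrightarrow> Z p) (at_right 0)"
      by (subst (asm) filterlim_at_right_to_0)
    then show ?thesis by (simp only: add_diff_cancel_right' add.commute)
  qed
  have "\<forall>\<^sub>F h in at_right 0. (LBINT x=p..p+h. Z x) / h = (LBINT x=r..r+h. Z x) / h"
  proof (rule eventually_mono[OF eventually_at_right_less])
    fix h :: real assume h: "0 < h"
    have "(r + h - r) * (LBINT x=p..p+h. Z x) = (p + h - p) * (LBINT x=r..r+h. Z x)"
      by (rule du_bois_reymond[OF Z test]) (use h assms(4,5) in auto)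
    then show "(LBINT x=p..p+h. Z x) / h = (LBINT x=r..r+h. Z x) / h" using h by simp
  qed
  with lim[OF assms(4)] have "((\<lambda>h. (LBINT x=r..r+h. Z x) / h) \<longlongrightarrow> Z p) (at_right 0)"
    by (rule Lim_transform_eventually)
  from tendsto_unique[OF trivial_limit_at_right_real this lim[OF assms(5)]] show ?thesis .
qed

section \<open>Conservation laws integrated in time\<close>

lemma fubini_box:
  fixes h :: "real \<times> real \<Rightarrow> real"
  assumes "h \<in> borel_measurable borel" "\<And>p. \<bar>h p\<bar> \<le> B"
    and "\<And>x y. x \<notin> {a..b} \<or> y \<notin> {c..d} \<Longrightarrow> h (x, y) = 0"
  shows "integrable lborel h"
    "(LINT p|lborel. h p) = (LINT x|lborel. LINT y|lborel. h (x, y))"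
    "(LINT p|lborel. h p) = (LINT y|lborel. LINT x|lborel. h (x, y))"
    "integrable lborel (\<lambda>x. LINT y|lborel. h (x, y))"
    "integrable lborel (\<lambda>y. LINT x|lborel. h (x, y))"
proof -
  show I: "integrable lborel h"
  proof (rule integrable_bounded_cbox[where a="(a,c)" and b="(b,d)" and B=B])
    show "h p = 0" if "p \<notin> cbox (a,c) (b,d)" for p
      using that assms(3) by (cases p) (auto simp: cbox_Pair_eq)
  qed (use assms in auto)
  then have I': "integrable (lborel \<Otimes>\<^sub>M lborel) (\<lambda>(x, y). h (x, y))"
    by (simp add: lborel_prod)
  show "(LINT p|lborel. h p) = (LINT x|lborel. LINT y|lborel. h (x, y))"
    using lborel_pair.integral_fst'[of "h"] I by (simp add: lborel_prod)
  moreover have "(LINT y|lborel. LINT x|lborel. h (x, y)) = (LINT x|lborel. LINT y|lborel. h (x, y))"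
    by (rule lborel_pair.Fubini_integral[OF I'])
  ultimately show "(LINT p|lborel. h p) = (LINT y|lborel. LINT x|lborel. h (x, y))" by simp
  show "integrable lborel (\<lambda>x. LINT y|lborel. h (x, y))"
    using lborel_pair.integrable_fst'[of h] I by (simp add: lborel_prod)
  show "integrable lborel (\<lambda>y. LINT x|lborel. h (x, y))"
    using lborel_pair.integrable_snd[OF I'] by simp
qed

lemma borel_slice:
  fixes h :: "real \<times> real \<Rightarrow> real"
  assumes "h \<in> borel_measurable borel"
  shows "(\<lambda>x. h (x, t)) \<in> borel_measurable borel" "(\<lambda>t. h (x, t)) \<in> borel_measurable borel"
  by (rule measurable_compose[OF borel_measurable_continuous_onI assms], intro continuous_intros)+

lemma borel_fst_snd:
  fixes h :: "real \<Rightarrow> real"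
  assumes "h \<in> borel_measurable borel"
  shows "(\<lambda>p::real \<times> real. h (fst p)) \<in> borel_measurable borel" "(\<lambda>p::real \<times> real. h (snd p)) \<in> borel_measurable borel"
  by (rule measurable_compose[OF borel_measurable_continuous_onI assms], intro continuous_intros)+

lemma borel_partial_integral:
  fixes h :: "real \<times> real \<Rightarrow> real"
  assumes "h \<in> borel_measurable borel"
  shows "(\<lambda>x. LINT y|lborel. h (x, y)) \<in> borel_measurable borel"
    "(\<lambda>y. LINT x|lborel. h (x, y)) \<in> borel_measurable borel"
proof -
  have "(\<lambda>(x, y). h (x, y)) \<in> borel_measurable (borel \<Otimes>\<^sub>M lborel)"
    using assms by (simp cong: measurable_cong_sets) (simp add: borel_prod)
  then show "(\<lambda>x. LINT y|lborel. h (x, y)) \<in> borel_measurable borel"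
    by (rule lborel.borel_measurable_lebesgue_integral)
  have "(\<lambda>p. h (snd p, fst p)) \<in> borel_measurable borel"
    by (rule measurable_compose[OF borel_measurable_continuous_onI assms]) (intro continuous_intros)
  then have "(\<lambda>(y, x). h (x, y)) \<in> borel_measurable (borel \<Otimes>\<^sub>M lborel)"
    by (simp add: case_prod_beta' cong: measurable_cong_sets) (simp add: borel_prod)
  then show "(\<lambda>y. LINT x|lborel. h (x, y)) \<in> borel_measurable borel"
    by (rule lborel.borel_measurable_lebesgue_integral)
qed

lemma smooth_on_C1:
  fixes a :: "real \<Rightarrow> real"
  assumes "smooth_on UNIV a" "\<And>x. x \<notin> {c..d} \<Longrightarrow> a x = 0"
  obtains A where "continuous_on UNIV a" "continuous_on UNIV (deriv a)"
    "\<And>x. (a has_real_derivative deriv a x) (at x)"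
    "\<And>x. x \<notin> {c..d} \<Longrightarrow> deriv a x = 0" "0 \<le> A" "\<And>x. \<bar>a x\<bar> \<le> A" "\<And>x. \<bar>deriv a x\<bar> \<le> A"
proof -
  have c: "continuous_on UNIV a" "continuous_on UNIV (deriv a)"
    using assms(1) smooth_on_deriv(2)[OF assms(1)] Ck_on_continuous unfolding smooth_on_def by blast+
  have d: "(a has_real_derivative deriv a x) (at x)" for x by (rule smooth_on_deriv[OF assms(1)])
  have z: "deriv a x = 0" if "x \<notin> {c..d}" for x
    using DERIV_zero_outside[of a "deriv a" c d x, OF d assms(2) that] .
  obtain A1 where A1: "0 \<le> A1" "\<And>x. x \<in> {c..d} \<Longrightarrow> \<bar>a x\<bar> \<le> A1"
    using loc_boundedE[OF loc_bounded_continuous[OF c(1)]] by metis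
  obtain A2 where A2: "0 \<le> A2" "\<And>x. x \<in> {c..d} \<Longrightarrow> \<bar>deriv a x\<bar> \<le> A2"
    using loc_boundedE[OF loc_bounded_continuous[OF c(2)]] by metis
  have "\<bar>a x\<bar> \<le> A1 + A2" "\<bar>deriv a x\<bar> \<le> A1 + A2" for x
    using A1(1) A2(1) A1(2)[of x] A2(2)[of x] assms(2)[of x] z[of x] by (cases "x \<in> {c..d}"; simp)+
  with that[of "A1 + A2"] c d z A1(1) A2(1) show ?thesis by simp
qed

lemma lipschitz_primitive:
  fixes w :: "real \<Rightarrow> real" and c x y :: real
  assumes "loc_bounded w" "\<And>x. \<bar>w x\<bar> \<le> B"
  shows "\<bar>(LBINT z=c..y. w z) - (LBINT z=c..x. w z)\<bar> \<le> B * \<bar>y - x\<bar>"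
proof -
  have B: "0 \<le> B" using assms(2)[of 0] by linarith
  show ?thesis
  proof (cases "x \<le> y")
    case True
    then show ?thesis
      using interval_integral_bound[OF True assms(2) B] primitive_diff[OF assms(1), of c y x] by simp
  next
    case False
    then show ?thesis
      using interval_integral_bound[of y x w B] assms(2) B primitive_diff[OF assms(1), of c x y]
      by (subst abs_minus_commute) simp
  qed
qed

lemma lipschitz_continuous_on:
  fixes f :: "real \<Rightarrow> real"
  assumes "\<And>x y. \<bar>f y - f x\<bar> \<le> B * \<bar>y - x\<bar>"
  shows "continuous_on S f"
proof -
  have "0 \<le> B" using assms[of 1 0] by simp
  then have "B-lipschitz_on S f"
    by (intro lipschitz_onI) (use assms in \<open>auto simp: dist_real_def\<close>)
  then show ?thesis by (rule lipschitz_on_continuous_on)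
qed

lemma loc_boundedI:
  "w \<in> borel_measurable borel \<Longrightarrow> (\<And>x. \<bar>w x\<bar> \<le> B) \<Longrightarrow> loc_bounded w"
  by (auto simp: loc_bounded_def)

text \<open>Testing with a(x) b(t) says that H(t), the integral of u(t) a, has distributional
  derivative -K(t) for t > 0, where K(t) is the integral of f(.,t) a'. Continuity of H turns this
  into H(t) - H(0) = - N(t) at every time, N being the primitive of K. An integration by parts in x
  moves the derivative onto a in the left side as well, which is the form that the du Bois-Reymond
  lemma takes as input.\<close>

lemma conservation_law_integrated:
  fixes U f :: "real \<times> real \<Rightarrow> real" and u :: "real \<Rightarrow> real \<Rightarrow> real"
  assumes U[measurable]: "U \<in> borel_measurable borel" and UB: "\<And>p. \<bar>U p\<bar> \<le> B"
    and f[measurable]: "f \<in> borel_measurable borel" and fB: "\<And>p. \<bar>f p\<bar> \<le> B"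
    and u[measurable]: "\<And>t. u t \<in> borel_measurable borel" and uB: "\<And>t x. \<bar>u t x\<bar> \<le> B"
    and ae: "AE t in lborel. t > 0 \<longrightarrow> (AE x in lborel. u t x = U (x, t))"
    and cont: "\<And>t c d. 0 \<le> t \<Longrightarrow> ((\<lambda>s. LINT x:{c..d}|lborel. \<bar>u s x - u t x\<bar>) \<longlongrightarrow> 0) (at t within {0..})"
    and weak: "\<And>a b c d c' d'. smooth_on UNIV a \<Longrightarrow> smooth_on UNIV b \<Longrightarrow> (\<And>x. x \<notin> {c..d} \<Longrightarrow> a x = 0) \<Longrightarrow>
        0 < c' \<Longrightarrow> (\<And>x. x \<notin> {c'..d'} \<Longrightarrow> b x = 0) \<Longrightarrow>
        (LINT p|lborel. U p * (a (fst p) * deriv b (snd p)) - f p * (deriv a (fst p) * b (snd p))) = 0"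
    and a: "smooth_on UNIV a" and az: "\<And>x. x \<notin> {c..d} \<Longrightarrow> a x = 0" and t: "0 \<le> t"
  shows "(LINT x|lborel. ((LBINT s=0..t. f (x, s)) - (LBINT y=0..x. u t y - u 0 y)) * deriv a x) = 0"
proof -
  have B0: "0 \<le> B" using UB[of 0] by linarith
  obtain A where ca: "continuous_on UNIV a" "continuous_on UNIV (deriv a)"
    and Da: "\<And>x. (a has_real_derivative deriv a x) (at x)"
    and da: "\<And>x. x \<notin> {c..d} \<Longrightarrow> deriv a x = 0" and A: "0 \<le> A" "\<And>x. \<bar>a x\<bar> \<le> A" "\<And>x. \<bar>deriv a x\<bar> \<le> A"
    by (rule smooth_on_C1[where c=c and d=d, OF a az]) blast+
  have am[measurable]: "a \<in> borel_measurable borel" "deriv a \<in> borel_measurable borel"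
    using ca by (auto intro: borel_measurable_continuous_onI)
  have ua: "integrable lborel (\<lambda>x. u t x * a x)" for t
    by (rule integrable_bounded_cbox[where a=c and b=d and B="B*A"])
       (use az B0 A uB in \<open>auto simp: abs_mult intro!: mult_mono\<close>)
  define H where "H t = (LINT x|lborel. u t x * a x)" for t
  define K where "K t = (LINT x|lborel. f (x, t) * deriv a x)" for t
  define N where "N t = (LBINT s=0..t. K s)" for t :: real
  have contH: "continuous_on {0..} H"
    unfolding continuous_on_def
  proof
    fix t :: real assume "t \<in> {0..}"
    then have "((\<lambda>s. A * (LINT x:{c..d}|lborel. \<bar>u s x - u t x\<bar>)) \<longlongrightarrow> A * 0) (at t within {0..})"
      by (intro tendsto_intros cont) auto
    then have lim: "((\<lambda>s. A * (LINT x:{c..d}|lborel. \<bar>u s x - u t x\<bar>)) \<longlongrightarrow> 0) (at t within {0..})" by simp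
    have "\<bar>H s - H t\<bar> \<le> A * (LINT x:{c..d}|lborel. \<bar>u s x - u t x\<bar>)" for s
    proof -
      have i: "integrable lborel (\<lambda>x. A * (indicator {c..d} x *\<^sub>R \<bar>u s x - u t x\<bar>))"
      proof (rule integrable_bounded_cbox[where a=c and b=d and B="A*(2*B)"])
        fix x
        have "\<bar>u s x - u t x\<bar> \<le> 2 * B" using uB[of s x] uB[of t x] by linarith
        then show "\<bar>A * (indicator {c..d} x *\<^sub>R \<bar>u s x - u t x\<bar>)\<bar> \<le> A*(2*B)"
          using A B0 by (auto simp: abs_mult indicator_def intro!: mult_mono)
      qed (auto simp: indicator_def)
      have "H s - H t = (LINT x|lborel. u s x * a x - u t x * a x)"
        unfolding H_def by (rule Bochner_Integration.integral_diff[symmetric]) (rule ua)+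
      also have "\<bar>\<dots>\<bar> \<le> (LINT x|lborel. \<bar>u s x * a x - u t x * a x\<bar>)"
        using integral_norm_bound[of lborel "\<lambda>x. u s x * a x - u t x * a x"] by simp
      also have "\<dots> \<le> (LINT x|lborel. A * (indicator {c..d} x *\<^sub>R \<bar>u s x - u t x\<bar>))"
      proof (rule integral_mono'[OF i])
        fix x
        have e: "\<bar>u s x * a x - u t x * a x\<bar> = \<bar>a x\<bar> * \<bar>u s x - u t x\<bar>"
          by (simp add: abs_mult[symmetric] algebra_simps)
        show "\<bar>u s x * a x - u t x * a x\<bar> \<le> A * (indicator {c..d} x *\<^sub>R \<bar>u s x - u t x\<bar>)"
          unfolding e using A(2)[of x] az[of x] by (cases "x \<in> {c..d}") (auto intro: mult_right_mono)
        show "0 \<le> A * (indicator {c..d} x *\<^sub>R \<bar>u s x - u t x\<bar>)" using A by simp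
      qed
      finally show ?thesis by (simp add: set_lebesgue_integral_def)
    qed
    then have "((\<lambda>s. H s - H t) \<longlongrightarrow> 0) (at t within {0..})"
      by (intro Lim_null_comparison[OF _ lim]) auto
    then show "(H \<longlongrightarrow> H t) (at t within {0..})" by (simp add: LIM_zero_iff)
  qed
  have fa: "(\<lambda>p. f p * deriv a (fst p)) \<in> borel_measurable borel"
    by (intro borel_measurable_times f borel_fst_snd am)
  have Km: "K \<in> borel_measurable borel"
    unfolding K_def using borel_partial_integral(2)[OF fa] by simp
  have faI: "integrable lborel (\<lambda>x. f (x, t) * deriv a x)" for t
    by (rule integrable_bounded_cbox[where a=c and b=d and B="B*A"])
       (use da B0 A fB borel_slice[OF f] in \<open>auto simp: abs_mult intro!: mult_mono\<close>)
  have KB: "\<bar>K t\<bar> \<le> B * A * \<bar>d - c\<bar>" for t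
  proof -
    have "\<bar>K t\<bar> \<le> (LINT x|lborel. \<bar>f (x, t) * deriv a x\<bar>)"
      unfolding K_def using integral_norm_bound[of lborel "\<lambda>x. f (x, t) * deriv a x"] by simp
    also have "\<dots> \<le> (LINT x|lborel. indicator {c..d} x * (B * A))"
    proof (rule integral_mono')
      show "integrable lborel (\<lambda>x. indicator {c..d} x * (B * A))"
        by (rule integrable_bounded_cbox[where a=c and b=d and B="B*A"])
           (use B0 A in \<open>auto simp: indicator_def\<close>)
      fix x
      show "\<bar>f (x, t) * deriv a x\<bar> \<le> indicator {c..d} x * (B * A)"
        using fB A(3) da[of x] B0 A(1) by (cases "x \<in> {c..d}") (auto simp: abs_mult intro!: mult_mono)
      show "0 \<le> indicator {c..d} x * (B * A)" using B0 A by simp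
    qed
    also have "\<dots> \<le> B * A * \<bar>d - c\<bar>" using B0 A by simp
    finally show ?thesis .
  qed
  have Kl: "loc_bounded K" using Km KB by (rule loc_boundedI)
  have contN: "continuous_on UNIV N"
    unfolding N_def zero_ereal_def by (rule lipschitz_continuous_on[OF lipschitz_primitive[OF Kl KB]])
  \<comment> \<open>H is continuous on t \<ge> 0 only; clipping the time extends it constantly, so
    that Z is continuous on the whole line.\<close>
  define Z where "Z t = H (max 0 t) + N t" for t
  have contHm: "continuous_on UNIV (\<lambda>t. H (max 0 t))"
    by (rule continuous_on_compose2[OF contH]) (auto intro!: continuous_intros)
  have contZ: "continuous_on UNIV Z" unfolding Z_def
    by (intro continuous_on_add contHm contN)
  have Ztest: "(LINT t|lborel. Z t * deriv b t) = 0"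
    if b: "smooth_on UNIV b" and c': "0 < c'" and bz: "\<And>x. x \<notin> {c'..d'} \<Longrightarrow> b x = 0" for b c' d'
  proof -
    obtain A' where cb: "continuous_on UNIV b" "continuous_on UNIV (deriv b)"
      and Db: "\<And>x. (b has_real_derivative deriv b x) (at x)"
      and db: "\<And>x. x \<notin> {c'..d'} \<Longrightarrow> deriv b x = 0" and A': "0 \<le> A'" "\<And>x. \<bar>b x\<bar> \<le> A'" "\<And>x. \<bar>deriv b x\<bar> \<le> A'"
      by (rule smooth_on_C1[where c=c' and d=d', OF b bz]) blast+
    have bm[measurable]: "b \<in> borel_measurable borel" "deriv b \<in> borel_measurable borel"
      using cb by (auto intro: borel_measurable_continuous_onI)
    \<comment> \<open>The two halves of Z give opposite values: this one by parts in time, the other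
      from the weak equation.\<close>
    have "(LINT t|lborel. N t * deriv b t) = - (LINT t|lborel. K t * b t)"
      by (rule integral_by_parts_primitive[OF Kl _ Db cb(2) bz])
         (simp add: N_def zero_ereal_def primitive_diff[OF Kl])
    moreover have "(LINT t|lborel. H (max 0 t) * deriv b t) = (LINT t|lborel. K t * b t)"
    proof -
      define h1 where "h1 p = U p * (a (fst p) * deriv b (snd p))" for p
      define h2 where "h2 p = f p * (deriv a (fst p) * b (snd p))" for p
      have m1: "h1 \<in> borel_measurable borel" unfolding h1_def
        by (intro borel_measurable_times U borel_fst_snd am bm)
      have m2: "h2 \<in> borel_measurable borel" unfolding h2_def
        by (intro borel_measurable_times f borel_fst_snd am bm)
      have b1: "\<bar>h1 p\<bar> \<le> B * (A * A')" "\<bar>h2 p\<bar> \<le> B * (A * A')" for p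
        unfolding h1_def h2_def abs_mult by (intro mult_mono; use UB fB A A' B0 in simp)+
      have z1: "h1 (x, y) = 0" "h2 (x, y) = 0" if "x \<notin> {c..d} \<or> y \<notin> {c'..d'}" for x y
        unfolding h1_def h2_def using that az[of x] da[of x] bz[of y] db[of y] by auto
      note F1 = fubini_box[OF m1 b1(1) z1(1)] and F2 = fubini_box[OF m2 b1(2) z1(2)]
      have "(LINT p|lborel. h1 p - h2 p) = 0"
        unfolding h1_def h2_def by (rule weak[OF a b az c' bz])
      then have "(LINT p|lborel. h1 p) = (LINT p|lborel. h2 p)"
        using F1(1) F2(1) by simp
      then have "(LINT y|lborel. LINT x|lborel. h1 (x, y)) = (LINT y|lborel. LINT x|lborel. h2 (x, y))"
        using F1(3) F2(3) by simp
      moreover have "(LINT x|lborel. h2 (x, y)) = K y * b y" for y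
        unfolding h2_def K_def by (simp add: mult.assoc[symmetric])
      moreover have "(LINT y|lborel. LINT x|lborel. h1 (x, y)) = (LINT t|lborel. H (max 0 t) * deriv b t)"
      proof (rule integral_cong_AE)
        show "(\<lambda>y. LINT x|lborel. h1 (x, y)) \<in> borel_measurable lborel"
          using borel_partial_integral(2)[OF m1] by simp
        show "(\<lambda>t. H (max 0 t) * deriv b t) \<in> borel_measurable lborel"
          using borel_measurable_continuous_onI[OF contHm] by simp
        \<comment> \<open>\<open>U\<close> is exchanged for the slices \<open>u t\<close> under the
          time integral, where a null set of times is harmless. For t \<le> 0 both sides vanish,
          since the support of b starts at c' > 0.\<close>
        show "AE t in lborel. (LINT x|lborel. h1 (x, t)) = H (max 0 t) * deriv b t"
          using ae
        proof (rule AE_mp, intro AE_I2 impI)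
          fix t :: real assume *: "0 < t \<longrightarrow> (AE x in lborel. u t x = U (x, t))"
          show "(LINT x|lborel. h1 (x, t)) = H (max 0 t) * deriv b t"
          proof (cases "t > 0")
            case False
            then show ?thesis using db[of t] c' by (simp add: h1_def)
          next
            case True
            have "(LINT x|lborel. h1 (x, t)) = (LINT x|lborel. U (x, t) * a x) * deriv b t"
              unfolding h1_def by (simp add: mult.assoc[symmetric])
            also have "(LINT x|lborel. U (x, t) * a x) = H t"
              unfolding H_def
            proof (rule integral_cong_AE)
              show "AE x in lborel. U (x, t) * a x = u t x * a x"
                using * True by auto
            qed (use borel_slice[OF U] in auto)
            finally show ?thesis using True by simp
          qed
        qed
      qed
      ultimately show ?thesis by simp
    qed
    moreover have I: "integrable lborel (\<lambda>t. g t * deriv b t)" if g: "continuous_on UNIV g" for g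
    proof -
      obtain C where C: "C \<ge> 0" "\<And>x. x \<in> {c'..d'} \<Longrightarrow> \<bar>g x\<bar> \<le> C"
        using loc_boundedE[OF loc_bounded_continuous[OF g]] by metis
      show ?thesis
      proof (rule integrable_bounded_cbox[where a=c' and b=d' and B="C*A'"])
        show "(\<lambda>t. g t * deriv b t) \<in> borel_measurable borel"
          using borel_measurable_continuous_onI[OF g] by simp
        show "g p * deriv b p = 0" if "p \<notin> cbox c' d'" for p using db[of p] that by simp
        show "\<bar>g p * deriv b p\<bar> \<le> C * A'" if "p \<in> cbox c' d'" for p
          unfolding abs_mult using C(2)[of p] A' C(1) that by (intro mult_mono) auto
      qed
    qed
    ultimately show ?thesis
      unfolding Z_def distrib_right
      using Bochner_Integration.integral_add[OF I[OF contHm] I[OF contN]] by simp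
  qed
  have const: "Z p = Z r" if "0 < p" "0 < r" for p r
    by (rule du_bois_reymond_continuous[OF loc_bounded_continuous[OF contZ] continuous_on_subset[OF contZ subset_UNIV] _ that])
       (rule Ztest)
  \<comment> \<open>The weak equation sees positive times only; the value at time 0 is reached by
    right continuity.\<close>
  have "Z 0 = Z t"
  proof (cases "t = 0")
    case False
    have "(Z \<longlongrightarrow> Z 0) (at_right 0)"
      using contZ by (auto simp: continuous_on_def intro: tendsto_within_subset)
    moreover have "\<forall>\<^sub>F s in at_right 0. Z s = Z t"
      by (rule eventually_mono[OF eventually_at_right_less]) (rule const, use t False in auto)
    then have "(Z \<longlongrightarrow> Z t) (at_right 0)" by (rule tendsto_eventually)
    ultimately show ?thesis by (rule tendsto_unique[OF trivial_limit_at_right_real])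
  qed simp
  then have "H t - H 0 = - N t" using t by (simp add: Z_def N_def zero_ereal_def[symmetric])
  moreover have "(LINT x|lborel. (u t x - u 0 x) * a x) = H t - H 0"
    unfolding H_def left_diff_distrib by (rule Bochner_Integration.integral_diff) (rule ua)+
  moreover define M P where "M x = (LBINT s=0..t. f (x, s))" and "P x = (LBINT y=0..x. u t y - u 0 y)" for x :: real
  have "integrable lborel (\<lambda>x. M x * deriv a x)" "N t = (LINT x|lborel. M x * deriv a x)"
  proof -
    \<comment> \<open>Integrating h first in x gives N t, first in time gives M against a'.\<close>
    define h where "h p = indicator {0<..t} (snd p) * (f p * deriv a (fst p))" for p
    have m: "h \<in> borel_measurable borel" unfolding h_def
      by (intro borel_measurable_times fa borel_fst_snd) simp
    have b: "\<bar>h p\<bar> \<le> B * A" for p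
      using fB[of p] A(3)[of "fst p"] B0 A(1) unfolding h_def by (auto simp: indicator_def abs_mult intro!: mult_mono)
    have z: "h (x, y) = 0" if "x \<notin> {c..d} \<or> y \<notin> {0..t}" for x y
      using that da[of x] by (auto simp: h_def indicator_def)
    note F = fubini_box[OF m b z]
    have "(LINT y|lborel. LINT x|lborel. h (x, y)) = N t"
      unfolding h_def N_def K_def zero_ereal_def using t
      by (simp add: interval_integral_Ioc set_lebesgue_integral_def)
    moreover have *: "(LINT y|lborel. h (x, y)) = M x * deriv a x" for x
      unfolding h_def M_def zero_ereal_def using t
      by (simp add: interval_integral_Ioc set_lebesgue_integral_def mult.assoc[symmetric])
    ultimately show "N t = (LINT x|lborel. M x * deriv a x)" using F(2,3) by simp
    show "integrable lborel (\<lambda>x. M x * deriv a x)" using F(4) unfolding * .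
  qed
  moreover have "integrable lborel (\<lambda>x. P x * deriv a x)"
    "(LINT x|lborel. P x * deriv a x) = - (LINT x|lborel. (u t x - u 0 x) * a x)"
  proof -
    have B2: "\<bar>u t x - u 0 x\<bar> \<le> 2 * B" for x using uB[of t x] uB[of 0 x] by linarith
    have lb: "loc_bounded (\<lambda>x. u t x - u 0 x)" using B2 by (intro loc_boundedI) simp_all
    show "(LINT x|lborel. P x * deriv a x) = - (LINT x|lborel. (u t x - u 0 x) * a x)"
      by (rule integral_by_parts_primitive[OF lb _ Da ca(2) az])
         (simp add: P_def zero_ereal_def primitive_diff[OF lb])
    have "continuous_on UNIV P"
      unfolding P_def zero_ereal_def by (rule lipschitz_continuous_on[OF lipschitz_primitive[OF lb B2]])
    then have "loc_bounded (\<lambda>x. P x * deriv a x)" by (intro loc_bounded_continuous continuous_on_mult ca)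
    from loc_bounded_set_integrable[OF this, of c d]
    show "integrable lborel (\<lambda>x. P x * deriv a x)"
      unfolding set_integrable_def
      by (rule Bochner_Integration.integrable_cong[THEN iffD1, rotated -1])
         (use da in \<open>auto simp: indicator_def\<close>)
  qed
  ultimately show ?thesis
    unfolding M_def[symmetric] P_def[symmetric] left_diff_distrib
    by (subst Bochner_Integration.integral_diff) simp_all
qed

section \<open>Test functions on the half plane\<close>

text \<open>Differentiability in \<open>Ck_on\<close> is total, while \<open>dx\<close> and
  \<open>dt\<close> are one-variable derivatives along lines. Restricting the total derivative to
  horizontal and vertical lines identifies them with its values at (1,0) and (0,1).\<close>

lemma Ck_on_Suc_partials:
  fixes f :: "real \<times> real \<Rightarrow> real"
  assumes "Ck_on (Suc k) UNIV f"
  shows "((\<lambda>x. f (x, t)) has_real_derivative dx f (x, t)) (at x)"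
    "((\<lambda>t. f (x, t)) has_real_derivative dt f (x, t)) (at t)"
    "Ck_on k UNIV (dx f)" "Ck_on k UNIV (dt f)"
proof -
  obtain D where D: "\<And>p. (f has_derivative D p) (at p)" "\<And>b. b\<in>Basis \<Longrightarrow> Ck_on k UNIV (\<lambda>p. D p b)"
    using assms unfolding Ck_on.simps by auto
  have 1: "((\<lambda>x. f (x, t)) has_real_derivative D (x, t) (1, 0)) (at x)" for x t
  proof -
    have "((\<lambda>x::real. (x, t)) has_derivative (\<lambda>h. (h, 0))) (at x)"
      by (auto intro!: derivative_eq_intros)
    from has_derivative_compose[OF this D(1)]
    have "((\<lambda>x. f (x, t)) has_derivative (\<lambda>h. D (x, t) (h, 0))) (at x)" .
    moreover have "D (x, t) (h, 0) = D (x, t) (1, 0) * h" for h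
      using linear_scale[OF has_derivative_linear[OF D(1)[of "(x,t)"]], of h "(1,0)"] by simp
    then have "(\<lambda>h. D (x, t) (h, 0)) = (*) (D (x, t) (1, 0))" by (intro ext)
    ultimately show ?thesis unfolding has_field_derivative_def by (simp only:)
  qed
  have 2: "((\<lambda>t. f (x, t)) has_real_derivative D (x, t) (0, 1)) (at t)" for x t
  proof -
    have "((\<lambda>t::real. (x, t)) has_derivative (\<lambda>h. (0, h))) (at t)"
      by (auto intro!: derivative_eq_intros)
    from has_derivative_compose[OF this D(1)]
    have "((\<lambda>t. f (x, t)) has_derivative (\<lambda>h. D (x, t) (0, h))) (at t)" .
    moreover have "D (x, t) (0, h) = D (x, t) (0, 1) * h" for h
      using linear_scale[OF has_derivative_linear[OF D(1)[of "(x,t)"]], of h "(0,1)"] by simp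
    then have "(\<lambda>h. D (x, t) (0, h)) = (*) (D (x, t) (0, 1))" by (intro ext)
    ultimately show ?thesis unfolding has_field_derivative_def by (simp only:)
  qed
  have dx: "dx f = (\<lambda>p. D p (1, 0))" unfolding dx_def using DERIV_imp_deriv[OF 1] by auto
  have dt: "dt f = (\<lambda>p. D p (0, 1))" unfolding dt_def using DERIV_imp_deriv[OF 2] by auto
  show "((\<lambda>x. f (x, t)) has_real_derivative dx f (x, t)) (at x)" using 1 dx by simp
  show "((\<lambda>t. f (x, t)) has_real_derivative dt f (x, t)) (at t)" using 2 dt by simp
  show "Ck_on k UNIV (dx f)" "Ck_on k UNIV (dt f)"
    unfolding dx dt by (rule D(2); simp add: Basis_prod_def)+
qed

lemma smooth_test_box:
  assumes "smooth_test \<phi>"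
  obtains a b c d where "0 < c" "\<And>x t. x \<notin> {a..b} \<or> t \<notin> {c..d} \<Longrightarrow> \<phi> (x, t) = 0"
proof -
  define K where "K = closure {p. \<phi> p \<noteq> 0}"
  have K: "compact K" "K \<subseteq> half_plane" using assms by (auto simp: smooth_test_def compact_support_in_def K_def)
  obtain r where r: "\<And>p. p \<in> K \<Longrightarrow> norm p \<le> r"
    using compact_imp_bounded[OF K(1)] by (auto simp: bounded_iff)
  \<comment> \<open>A compact subset of the open half plane has a least time coordinate, and it is
    positive.\<close>
  obtain c where c: "0 < c" "\<And>p. p \<in> K \<Longrightarrow> c \<le> snd p"
  proof (cases "K = {}")
    case False
    have "compact (snd ` K)" by (intro compact_continuous_image K continuous_intros)
    then obtain s where "s \<in> snd ` K" "\<forall>t\<in>snd ` K. s \<le> t"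
      using compact_attains_inf[of "snd ` K"] False by auto
    then show ?thesis using that[of s] K(2) by auto
  next
    case True
    then show ?thesis using that[of 1] by auto
  qed
  have "\<phi> (x, t) = 0" if *: "x \<notin> {-r..r} \<or> t \<notin> {c..r}" for x t
  proof (rule ccontr)
    assume "\<phi> (x, t) \<noteq> 0"
    then have "(x, t) \<in> K" unfolding K_def using closure_subset by fastforce
    then have "norm (x, t) \<le> r" "c \<le> t" using r c(2) by force+
    moreover have "\<bar>x\<bar> \<le> norm (x, t)" "\<bar>t\<bar> \<le> norm (x, t)"
      using norm_fst_le[of x t] norm_snd_le[of t x] by auto
    ultimately show False using * by auto
  qed
  with c(1) show ?thesis using that by blast
qed

lemma bounded_if_zero_off_box:
  fixes g :: "real \<times> real \<Rightarrow> real"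
  assumes g: "continuous_on UNIV g" and z: "\<And>x t. x \<notin> {a..b} \<or> t \<notin> {c..d} \<Longrightarrow> g (x, t) = 0"
  shows "\<exists>C\<ge>0. \<forall>p. \<bar>g p\<bar> \<le> C"
proof -
  have "bounded (g ` cbox (a, c) (b, d))"
    by (intro compact_imp_bounded compact_continuous_image continuous_on_subset[OF g]) auto
  then obtain C where C: "\<And>p. p \<in> cbox (a, c) (b, d) \<Longrightarrow> \<bar>g p\<bar> \<le> C" by (auto simp: bounded_iff)
  have "\<bar>g p\<bar> \<le> \<bar>C\<bar>" for p
  proof (cases "p \<in> cbox (a, c) (b, d)")
    case True
    then show ?thesis using C[of p] by linarith
  next
    case False
    then show ?thesis using z[of "fst p" "snd p"] by (cases p) (auto simp: cbox_Pair_eq)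
  qed
  then show ?thesis by (intro exI[of _ "\<bar>C\<bar>"]) simp
qed

text \<open>The mixed derivative is included because the time equation for the position is checked
  by an integration by parts in x against \<open>dt \<phi>\<close>.\<close>

lemma smooth_test_facts:
  assumes "smooth_test \<phi>"
  obtains a b c d C where "0 < c" "0 \<le> C"
    "\<And>x t. x \<notin> {a..b} \<or> t \<notin> {c..d} \<Longrightarrow> \<phi> (x, t) = 0 \<and> dx \<phi> (x, t) = 0 \<and> dt \<phi> (x, t) = 0"
    "\<And>p. \<bar>\<phi> p\<bar> \<le> C" "\<And>p. \<bar>dx \<phi> p\<bar> \<le> C" "\<And>p. \<bar>dt \<phi> p\<bar> \<le> C"
    "continuous_on UNIV \<phi>" "continuous_on UNIV (dx \<phi>)" "continuous_on UNIV (dt \<phi>)"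
    "\<And>x t. ((\<lambda>x. \<phi> (x, t)) has_real_derivative dx \<phi> (x, t)) (at x)"
    "\<And>x t. ((\<lambda>t. \<phi> (x, t)) has_real_derivative dt \<phi> (x, t)) (at t)"
    "\<And>x t. ((\<lambda>x. dt \<phi> (x, t)) has_real_derivative dx (dt \<phi>) (x, t)) (at x)" "continuous_on UNIV (dx (dt \<phi>))"
proof -
  have C2: "Ck_on (Suc (Suc 0)) UNIV \<phi>" using assms unfolding smooth_test_def smooth_on_def by blast
  note P = Ck_on_Suc_partials[OF C2]
  note Q = Ck_on_Suc_partials[OF P(4)]
  have cont: "continuous_on UNIV \<phi>" "continuous_on UNIV (dx \<phi>)" "continuous_on UNIV (dt \<phi>)" "continuous_on UNIV (dx (dt \<phi>))"
    using Ck_on_continuous C2 P Q by blast+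
  obtain a b c d where c: "0 < c" and z: "\<And>x t. x \<notin> {a..b} \<or> t \<notin> {c..d} \<Longrightarrow> \<phi> (x, t) = 0"
    by (rule smooth_test_box[OF assms]) blast
  have z': "\<phi> (x, t) = 0 \<and> dx \<phi> (x, t) = 0 \<and> dt \<phi> (x, t) = 0" if *: "x \<notin> {a..b} \<or> t \<notin> {c..d}" for x t
  proof -
    have "dx \<phi> (x, t) = 0"
    proof (cases "t \<in> {c..d}")
      case True
      then have "\<phi> (y, t) = 0" if "y \<notin> {a..b}" for y using z that by blast
      moreover have "x \<notin> {a..b}" using True * by blast
      ultimately show ?thesis
        using DERIV_zero_outside[where g="\<lambda>x. \<phi> (x, t)" and g'="\<lambda>x. dx \<phi> (x, t)" and c=a and d=b and x=x, OF P(1)] by blast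
    next
      case False
      then have "(\<lambda>x. \<phi> (x, t)) = (\<lambda>_. 0)" using z by blast
      then show ?thesis unfolding dx_def by simp
    qed
    moreover have "dt \<phi> (x, t) = 0"
    proof (cases "x \<in> {a..b}")
      case True
      then have "\<phi> (x, s) = 0" if "s \<notin> {c..d}" for s using z that by blast
      moreover have "t \<notin> {c..d}" using True * by blast
      ultimately show ?thesis
        using DERIV_zero_outside[where g="\<lambda>t. \<phi> (x, t)" and g'="\<lambda>t. dt \<phi> (x, t)" and c=c and d=d and x=t, OF P(2)] by blast
    next
      case False
      then have "(\<lambda>t. \<phi> (x, t)) = (\<lambda>_. 0)" using z by blast
      then show ?thesis unfolding dt_def by simp
    qed
    ultimately show ?thesis using z * by blast
  qed
  obtain C1 where C1: "C1 \<ge> 0" "\<And>p. \<bar>\<phi> p\<bar> \<le> C1" using bounded_if_zero_off_box[OF cont(1)] z' by metis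
  obtain C2 where C2: "C2 \<ge> 0" "\<And>p. \<bar>dx \<phi> p\<bar> \<le> C2" using bounded_if_zero_off_box[OF cont(2)] z' by metis
  obtain C3 where C3: "C3 \<ge> 0" "\<And>p. \<bar>dt \<phi> p\<bar> \<le> C3" using bounded_if_zero_off_box[OF cont(3)] z' by metis
  have "\<bar>\<phi> p\<bar> \<le> C1 + C2 + C3 \<and> \<bar>dx \<phi> p\<bar> \<le> C1 + C2 + C3 \<and> \<bar>dt \<phi> p\<bar> \<le> C1 + C2 + C3" for p
    using C1(1) C2(1) C3(1) C1(2)[of p] C2(2)[of p] C3(2)[of p] by linarith
  then show ?thesis
    using that[of c "C1 + C2 + C3" a b d] c z' cont P(1,2) Q(1) C1(1) C2(1) C3(1) by simp
qed

lemma smooth_test_product: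
  fixes a b :: "real \<Rightarrow> real"
  assumes a: "smooth_on UNIV a" and az: "\<And>x. x \<notin> {c..d} \<Longrightarrow> a x = 0"
    and b: "smooth_on UNIV b" and bz: "\<And>x. x \<notin> {c'..d'} \<Longrightarrow> b x = 0" and c': "0 < c'"
  shows "smooth_test (\<lambda>p. a (fst p) * b (snd p))"
    "dx (\<lambda>p. a (fst p) * b (snd p)) p = deriv a (fst p) * b (snd p)"
    "dt (\<lambda>p. a (fst p) * b (snd p)) p = a (fst p) * deriv b (snd p)"
proof -
  have sm: "smooth_on UNIV (\<lambda>p::real\<times>real. a (fst p) * b (snd p))"
    using smooth_on_mult[OF smooth_on_affine[OF a, of "(1::real,0::real)" 0] smooth_on_affine[OF b, of "(0::real,1::real)" 0]]
    by (simp add: inner_prod_def)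
  have "{p. a (fst p) * b (snd p) \<noteq> 0} \<subseteq> cbox (c, c') (d, d')"
    using az bz by (fastforce simp: cbox_Pair_eq)
  then have sub: "closure {p. a (fst p) * b (snd p) \<noteq> 0} \<subseteq> cbox (c, c') (d, d')"
    by (rule closure_minimal) (rule closed_cbox)
  have "compact (closure {p. a (fst p) * b (snd p) \<noteq> 0})"
    unfolding compact_eq_bounded_closed using bounded_subset[OF bounded_cbox sub] by blast
  moreover have "cbox (c, c') (d, d') \<subseteq> half_plane" using c' by (auto simp: cbox_Pair_eq)
  ultimately have "compact_support_in half_plane (\<lambda>p. a (fst p) * b (snd p))"
    unfolding compact_support_in_def using sub by blast
  with sm show "smooth_test (\<lambda>p. a (fst p) * b (snd p))" unfolding smooth_test_def by blast
  show "dx (\<lambda>p. a (fst p) * b (snd p)) p = deriv a (fst p) * b (snd p)"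
    unfolding dx_def using DERIV_cmult_right[OF smooth_on_deriv(1)[OF a]] by (auto intro!: DERIV_imp_deriv)
  show "dt (\<lambda>p. a (fst p) * b (snd p)) p = a (fst p) * deriv b (snd p)"
    unfolding dt_def using DERIV_cmult[OF smooth_on_deriv(1)[OF b]] by (auto intro!: DERIV_imp_deriv)
qed

section \<open>From completed Lebesgue measure to Borel representatives\<close>

lemma half_plane_integral:
  fixes h hb :: "real \<times> real \<Rightarrow> real"
  assumes hb: "hb \<in> borel_measurable borel"
    and "AE p in lborel. p \<in> half_plane \<longrightarrow> h p = hb p" "\<And>p. p \<notin> half_plane \<Longrightarrow> hb p = 0"
  shows "(LINT p:half_plane|lebesgue. h p) = (LINT p|lborel. hb p)"
proof -
  have hb': "hb \<in> borel_measurable lebesgue"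
    by (rule measurable_completion) (use hb in simp)
  \<comment> \<open>As hb vanishes off the half plane, the indicator is absorbed; completion leaves
    the integral of a Borel function unchanged.\<close>
  have "AE p in lborel. hb p = indicator half_plane p *\<^sub>R h p"
    using assms(2) by eventually_elim (use assms(3) in \<open>auto simp: indicator_def\<close>)
  then have ae: "AE p in lebesgue. hb p = indicator half_plane p *\<^sub>R h p" by (rule AE_completion)
  have "(LINT p|lebesgue. hb p) = (LINT p:half_plane|lebesgue. h p)"
    unfolding set_lebesgue_integral_def
    by (rule integral_cong_AE[OF hb' borel_measurable_AE[OF hb' ae] ae])
  then show ?thesis using integral_completion[of hb lborel] hb by simp
qed

lemma bounded_borel_version:
  fixes g :: "'a::euclidean_space \<Rightarrow> real"
  assumes "g \<in> borel_measurable lebesgue" "\<And>x. \<bar>g x\<bar> \<le> B"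
  shows "\<exists>g'. g' \<in> borel_measurable borel \<and> (\<forall>x. \<bar>g' x\<bar> \<le> B) \<and> (AE x in lborel. g x = g' x)"
proof -
  obtain g' where g': "g' \<in> borel_measurable lborel" "AE x in lborel. g x = g' x"
    using completion_ex_borel_measurable_real[OF assms(1)] by blast
  have "0 \<le> B" using assms(2)[of undefined] by linarith
  show ?thesis
  \<comment> \<open>Clamping makes the bound hold everywhere instead of almost everywhere.\<close>
  proof (intro exI[of _ "\<lambda>x. max (-B) (min B (g' x))"] conjI allI)
    show "(\<lambda>x. max (-B) (min B (g' x))) \<in> borel_measurable borel" using g'(1) by simp
    show "\<bar>max (-B) (min B (g' x))\<bar> \<le> B" for x using \<open>0 \<le> B\<close> by auto
    show "AE x in lborel. g x = max (-B) (min B (g' x))"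
      using g'(2)
    proof eventually_elim
      case (elim x)
      then show ?case using assms(2)[of x] by (simp add: abs_le_iff)
    qed
  qed
qed

text \<open>The exceptional set is enlarged to a Borel null set N, because exchanging the two
  almost-everywhere quantifiers requires a measurable set; the exchange puts time outside.\<close>

lemma AE_slices:
  assumes "AE p in (lborel :: (real \<times> real) measure). Q p"
  shows "AE t in lborel. AE x in lborel. Q (x, t)"
proof -
  obtain N where N: "{p \<in> space lborel. \<not> Q p} \<subseteq> N" "N \<in> null_sets (lborel :: (real \<times> real) measure)"
    using assms by (auto elim!: AE_E simp: null_sets_def)
  have "AE p in (lborel :: (real \<times> real) measure). p \<notin> N" using N(2) by (rule AE_not_in)
  then have "AE p in lborel \<Otimes>\<^sub>M lborel. p \<notin> N" unfolding lborel_prod .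
  then have "AE x in lborel. AE t in lborel. (x, t) \<notin> N" by (rule lborel_pair.AE_pair)
  moreover have "{p \<in> space (lborel \<Otimes>\<^sub>M lborel). (fst p, snd p) \<notin> N} \<in> sets (lborel \<Otimes>\<^sub>M lborel)"
  proof -
    have "{p \<in> space (lborel \<Otimes>\<^sub>M lborel). (fst p, snd p) \<notin> N} = - N" by (auto simp: lborel_prod)
    moreover have "- N \<in> sets (lborel :: (real \<times> real) measure)" using N(2) by (auto simp: null_sets_def)
    ultimately show ?thesis unfolding lborel_prod by simp
  qed
  ultimately have "AE t in lborel. AE x in lborel. (x, t) \<notin> N"
    using lborel_pair.AE_commute[of "\<lambda>x t. (x, t) \<notin> N"] by blast
  then show ?thesis
  proof eventually_elim
    case (elim t)
    then show ?case by eventually_elim (use N(1) in auto)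
  qed
qed

section \<open>Lipschitz bounds and absolute continuity\<close>

lemma abs_continuous_lipschitz:
  assumes "\<And>x y. \<bar>f y - f x\<bar> \<le> B * \<bar>y - x\<bar>"
  shows "abs_continuous f"
  unfolding abs_continuous_def abs_continuous_on_interval_def
proof (intro allI impI)
  fix c d \<epsilon> :: real assume \<epsilon>: "0 < \<epsilon>"
  have B: "0 \<le> B" using assms[of 1 0] by simp
  show "\<exists>\<delta>>0. \<forall>n. \<forall>l u :: nat \<Rightarrow> real. (\<forall>i<n. c \<le> l i \<and> l i \<le> u i \<and> u i \<le> d) \<longrightarrow>
      disjoint_family_on (\<lambda>i. {l i<..<u i}) {..<n} \<longrightarrow> (\<Sum>i<n. u i - l i) < \<delta> \<longrightarrow>
      (\<Sum>i<n. \<bar>f (u i) - f (l i)\<bar>) < \<epsilon>"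
  \<comment> \<open>Dividing by B + 1 also covers B = 0.\<close>
  proof (intro exI[of _ "\<epsilon> / (B + 1)"] conjI allI impI)
    show "0 < \<epsilon> / (B + 1)" using \<epsilon> B by simp
    fix n :: nat and l u :: "nat \<Rightarrow> real"
    assume lu: "\<forall>i<n. c \<le> l i \<and> l i \<le> u i \<and> u i \<le> d" and "disjoint_family_on (\<lambda>i. {l i<..<u i}) {..<n}"
      and s: "(\<Sum>i<n. u i - l i) < \<epsilon> / (B + 1)"
    have s0: "0 \<le> (\<Sum>i<n. u i - l i)" using lu by (intro sum_nonneg) auto
    have "(\<Sum>i<n. \<bar>f (u i) - f (l i)\<bar>) \<le> (\<Sum>i<n. B * (u i - l i))"
    proof (rule sum_mono)
      fix i assume "i \<in> {..<n}"
      then have "l i \<le> u i" using lu by simp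
      then show "\<bar>f (u i) - f (l i)\<bar> \<le> B * (u i - l i)" using assms[of "u i" "l i"] by simp
    qed
    also have "\<dots> = B * (\<Sum>i<n. u i - l i)" by (simp add: sum_distrib_left)
    also have "\<dots> \<le> (B + 1) * (\<Sum>i<n. u i - l i)" using s0 by (intro mult_right_mono) auto
    also have "\<dots> < \<epsilon>" using s B by (simp add: pos_less_divide_eq mult.commute)
    finally show "(\<Sum>i<n. \<bar>f (u i) - f (l i)\<bar>) < \<epsilon>" .
  qed
qed

text \<open>The lower bound gives three things: injectivity, growth to both infinities and hence
  surjectivity, and the Lipschitz constant 1/m of the inverse.\<close>

lemma bilipschitz_abs_continuous:
  fixes g :: "real \<Rightarrow> real"
  assumes m: "0 < m" and lo: "\<And>x y. x \<le> y \<Longrightarrow> m * (y - x) \<le> g y - g x"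
    and up: "\<And>x y. \<bar>g y - g x\<bar> \<le> B * \<bar>y - x\<bar>"
  shows "abs_continuous g \<and> bij g \<and> abs_continuous (inv g)"
proof -
  have lo': "m * \<bar>y - x\<bar> \<le> \<bar>g y - g x\<bar>" for x y
    using lo[of x y] lo[of y x] by (cases "x \<le> y") auto
  have "inj g"
  proof (rule injI)
    fix x y assume "g x = g y"
    then have "m * \<bar>y - x\<bar> \<le> 0" using lo'[of y x] by simp
    then show "x = y" using m by (simp add: mult_le_0_iff)
  qed
  moreover have "surj g"
  proof (rule surjI)
    fix z
    \<comment> \<open>Chosen so that m r = |z| + |g 0|: then g(-r) \<le> g 0 - m r \<le> z, and
      symmetrically z \<le> g r.\<close>
    define r where "r = (\<bar>z\<bar> + \<bar>g 0\<bar>) / m"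
    have r: "0 \<le> r" "m * r = \<bar>z\<bar> + \<bar>g 0\<bar>" using m by (auto simp: r_def)
    have "g (-r) \<le> z" using lo[of "-r" 0] r by simp
    moreover have "z \<le> g r" using lo[of 0 r] r by simp
    moreover have "continuous_on {-r..r} g" using up by (rule lipschitz_continuous_on)
    ultimately have "\<exists>x. g x = z" using IVT'[of g "-r" z r] r by fastforce
    then show "g (SOME x. g x = z) = z" by (rule someI_ex)
  qed
  ultimately have b: "bij g" by (rule bijI)
  have "\<bar>inv g y - inv g x\<bar> \<le> 1 / m * \<bar>y - x\<bar>" for x y
    using lo'[of "inv g y" "inv g x"] surj_f_inv_f[OF \<open>surj g\<close>] m by (simp add: field_simps)
  with b show ?thesis using abs_continuous_lipschitz up by blast
qed

section \<open>Continuous functions with vanishing weak time derivative\<close>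

lemma continuous_partial_integral:
  fixes D :: "real \<times> real \<Rightarrow> real" and b :: "real \<Rightarrow> real"
  assumes D: "continuous_on UNIV D" and b: "continuous_on UNIV b" and bz: "\<And>t. t \<notin> {c..d} \<Longrightarrow> b t = 0"
  shows "continuous_on UNIV (\<lambda>x. LINT t|lborel. D (x, t) * b t)"
proof -
  have "(LINT t|lborel. D (x, t) * b t) = integral {c..d} (\<lambda>t. D (x, t) * b t)" for x
  proof -
    have c: "continuous_on UNIV (\<lambda>t. D (x, t) * b t)"
      by (intro continuous_intros continuous_on_compose2[OF D] b) auto
    have "(LINT t|lborel. D (x, t) * b t) = (LINT t:{c..d}|lborel. D (x, t) * b t)"
      unfolding set_lebesgue_integral_def
    proof (intro Bochner_Integration.integral_cong refl)
      show "D (x, t) * b t = indicator {c..d} t *\<^sub>R (D (x, t) * b t)" for t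
        using bz[of t] by (cases "t \<in> {c..d}") auto
    qed
    also have "\<dots> = integral {c..d} (\<lambda>t. D (x, t) * b t)"
      by (rule set_borel_integral_eq_integral(2)) (rule loc_bounded_set_integrable[OF loc_bounded_continuous[OF c]])
    finally show ?thesis .
  qed
  moreover have "continuous_on UNIV (\<lambda>x. integral (cbox c d) (\<lambda>t. D (x, t) * b t))"
    by (rule integral_continuous_on_param)
       (auto simp: case_prod_beta intro!: continuous_intros continuous_on_compose2[OF D] continuous_on_compose2[OF b])
  ultimately show ?thesis by simp
qed

text \<open>Testing with a(x) b(t) shows that J(x), the integral of D(x,t) b'(t) over t, is
  orthogonal to every a. Since J is continuous it vanishes at every x, so each slice D(x,.)
  satisfies the one-variable weak equation and is constant for t > 0, with value D(x,0) = 0 in the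
  limit.\<close>

lemma zero_if_weak_dt_zero:
  fixes D :: "real \<times> real \<Rightarrow> real"
  assumes D: "continuous_on UNIV D" and init: "\<And>x. D (x, 0) = 0"
    and weak: "\<And>\<phi>. smooth_test \<phi> \<Longrightarrow> (LINT p|lborel. D p * dt \<phi> p) = 0"
    and t: "0 \<le> t"
  shows "D (x, t) = 0"
proof -
  have slice: "continuous_on UNIV (\<lambda>s. D (x, s))" for x
    by (intro continuous_on_compose2[OF D] continuous_intros) auto
  have J0: "(LINT t|lborel. D (x, t) * deriv b t) = 0"
    if b: "smooth_on UNIV b" and c': "0 < c'" and bz: "\<And>x. x \<notin> {c'..d'} \<Longrightarrow> b x = 0" for b c' d' x
  proof -
    obtain A' where cb: "continuous_on UNIV b" "continuous_on UNIV (deriv b)"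
      and Db: "\<And>x. (b has_real_derivative deriv b x) (at x)"
      and db: "\<And>x. x \<notin> {c'..d'} \<Longrightarrow> deriv b x = 0" and A': "0 \<le> A'" "\<And>x. \<bar>b x\<bar> \<le> A'" "\<And>x. \<bar>deriv b x\<bar> \<le> A'"
      by (rule smooth_on_C1[where c=c' and d=d', OF b bz]) blast+
    define J where "J x = (LINT t|lborel. D (x, t) * deriv b t)" for x
    have cJ: "continuous_on UNIV J"
      unfolding J_def by (rule continuous_partial_integral[OF D cb(2) db])
    \<comment> \<open>The du Bois-Reymond lemma tests against a', not a. Passing to a primitive Q of
      J supplies the missing derivative; Q is then constant, so J = Q' = 0.\<close>
    obtain Q where Q: "\<And>x. (Q has_real_derivative J x) (at x)"
      using antiderivative_exists[OF cJ] by blast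
    have cQ: "continuous_on UNIV Q" using Q by (meson DERIV_continuous_on DERIV_subset subset_UNIV)
    have test: "(LINT x|lborel. Q x * deriv a x) = 0"
      if a: "smooth_on UNIV a" and "l < c" and az: "\<And>x. x \<notin> {c..d} \<Longrightarrow> a x = 0" for a c d l
    proof -
      obtain A where ca: "continuous_on UNIV a" "continuous_on UNIV (deriv a)"
        and Da: "\<And>x. (a has_real_derivative deriv a x) (at x)"
        and da: "\<And>x. x \<notin> {c..d} \<Longrightarrow> deriv a x = 0" and A: "0 \<le> A" "\<And>x. \<bar>a x\<bar> \<le> A" "\<And>x. \<bar>deriv a x\<bar> \<le> A"
        by (rule smooth_on_C1[where c=c and d=d, OF a az]) blast+
      have QJ: "Q x - Q c = (LBINT z=c..x. J z)" for x
        by (rule interval_integral_FTC_finite[symmetric])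
           (auto intro: continuous_on_subset[OF cJ] has_field_derivative_at_within Q
              simp: has_real_derivative_iff_has_vector_derivative[symmetric])
      have "(LINT x|lborel. Q x * deriv a x) = - (LINT x|lborel. J x * a x)"
        by (rule integral_by_parts_primitive[OF loc_bounded_continuous[OF cJ] QJ Da ca(2) az])
      also have "(LINT x|lborel. J x * a x) = (LINT p|lborel. D p * (a (fst p) * deriv b (snd p)))"
      proof -
        define h where "h p = D p * (a (fst p) * deriv b (snd p))" for p
        have ch: "continuous_on UNIV h" unfolding h_def
          by (intro continuous_on_mult D continuous_on_compose2[OF ca(1)] continuous_on_compose2[OF cb(2)] continuous_intros) auto
        have zh: "h (x, t) = 0" if "x \<notin> {c..d} \<or> t \<notin> {c'..d'}" for x t
          unfolding h_def using that az[of x] db[of t] by auto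
        obtain C where C: "\<And>p. \<bar>h p\<bar> \<le> C" using bounded_if_zero_off_box[OF ch zh] by blast
        have "(LINT t|lborel. h (x, t)) = J x * a x" for x
        proof -
          have "(LINT t|lborel. h (x, t)) = (LINT t|lborel. a x * (D (x, t) * deriv b t))"
            unfolding h_def fst_conv snd_conv by (rule Bochner_Integration.integral_cong) (auto simp only: ac_simps)
          then show ?thesis unfolding J_def by (simp only: integral_mult_right_zero mult.commute)
        qed
        then show ?thesis
          using fubini_box(2)[OF borel_measurable_continuous_onI[OF ch] C zh] unfolding h_def by simp
      qed
      also have "\<dots> = (LINT p|lborel. D p * dt (\<lambda>p. a (fst p) * b (snd p)) p)"
        using smooth_test_product(3)[OF a az b bz c'] by simp
      also have "\<dots> = 0" by (rule weak[OF smooth_test_product(1)[OF a az b bz c']])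
      finally show ?thesis by simp
    qed
    have "Q y = Q 0" for y
      \<comment> \<open>The bound lies to the left of both y and 0.\<close>
      by (rule du_bois_reymond_continuous[where l="- \<bar>y\<bar> - 1", OF loc_bounded_continuous[OF cQ] continuous_on_subset[OF cQ subset_UNIV] test])
         auto
    then have "Q = (\<lambda>_. Q 0)" by (rule ext)
    moreover have "((\<lambda>_. Q 0) has_real_derivative 0) (at x)" by (rule DERIV_const)
    ultimately have "(Q has_real_derivative 0) (at x)" by (simp only:)
    from DERIV_unique[OF Q this] show ?thesis unfolding J_def .
  qed
  have const: "D (x, p) = D (x, r)" if "0 < p" "0 < r" for p r
    by (rule du_bois_reymond_continuous[OF loc_bounded_continuous[OF slice] continuous_on_subset[OF slice subset_UNIV] _ that])
       (rule J0)
  show ?thesis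
  proof (cases "t = 0")
    case False
    have "((\<lambda>s. D (x, s)) \<longlongrightarrow> D (x, 0)) (at_right 0)"
      using slice[of x] by (auto simp: continuous_on_def intro: tendsto_within_subset)
    moreover have "\<forall>\<^sub>F s in at_right 0. D (x, s) = D (x, t)"
      by (rule eventually_mono[OF eventually_at_right_less]) (rule const, use t False in auto)
    then have "((\<lambda>s. D (x, s)) \<longlongrightarrow> D (x, t)) (at_right 0)" by (rule tendsto_eventually)
    ultimately have "D (x, 0) = D (x, t)" by (rule tendsto_unique[OF trivial_limit_at_right_real])
    then show ?thesis using init by simp
  qed (simp add: init)
qed

section \<open>The position function\<close>

text \<open>Here \<open>e t\<close> stands for a Borel version of \<eta>(.,t), chosen separately for
  each t, and \<open>f\<close> for a planar Borel version of G(v/\<eta>). Joint measurability of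
  \<open>e\<close> in (t, x) is not part of the data; \<open>balance\<close> is the conclusion of
  \<open>conservation_law_integrated\<close>.\<close>

locale position_data =
  fixes B :: real and e :: "real \<Rightarrow> real \<Rightarrow> real" and f :: "real \<times> real \<Rightarrow> real"
  assumes e_borel[measurable]: "e t \<in> borel_measurable borel" and e_bound: "\<bar>e t x\<bar> \<le> B"
    and f_borel[measurable]: "f \<in> borel_measurable borel" and f_bound: "\<bar>f p\<bar> \<le> B"
    and e_init: "AE x in lborel. e 0 x = 1"
    and e_cont: "0 \<le> t \<Longrightarrow> ((\<lambda>s. LINT x:{c..d}|lborel. \<bar>e s x - e t x\<bar>) \<longlongrightarrow> 0) (at t within {0..})"
    and balance: "0 \<le> t \<Longrightarrow> smooth_on UNIV a \<Longrightarrow> (\<And>x. x \<notin> {c..d} \<Longrightarrow> a x = 0) \<Longrightarrow>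
      (LINT x|lborel. ((LBINT s=0..t. f (x, s)) - (LBINT y=0..x. e t y - e 0 y)) * deriv a x) = 0"
begin

definition x_primitive :: "real \<Rightarrow> real \<Rightarrow> real" where "x_primitive t x = (LBINT y=0..x. e t y)"

definition t_primitive :: "real \<Rightarrow> real \<Rightarrow> real" where "t_primitive x t = (LBINT s=0..t. f (x, s))"

text \<open>For each \<open>t \<ge> 0\<close> the function \<open>x + t_primitive x t - x_primitive t x\<close> is almost everywhere constant in
  \<open>x\<close>; the constant is recovered as its mean over \<open>[0, 1]\<close>.\<close>

definition offset :: "real \<Rightarrow> real" where "offset t = (LBINT x=0..1. x + t_primitive x t - x_primitive t x)"

text \<open>Clipping the time at 0 makes the function continuous on the whole plane, so that it can
  be integrated against test functions without restricting to the half plane.\<close>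

definition position :: "real \<times> real \<Rightarrow> real" where
  "position p = x_primitive (max 0 (snd p)) (fst p) + offset (max 0 (snd p))"

lemma B_nonneg: "0 \<le> B" using e_bound[of 0 0] by linarith

lemma e_loc: "loc_bounded (e t)" using e_borel e_bound by (rule loc_boundedI)

lemma f_loc: "loc_bounded (\<lambda>s. f (x, s))"
  using borel_slice(2)[OF f_borel] f_bound by (rule loc_boundedI)

lemma x_primitive_diff: "x_primitive t y - x_primitive t x = (LBINT z=x..y. e t z)"
  unfolding x_primitive_def zero_ereal_def by (rule primitive_diff[OF e_loc])

lemma x_primitive_lipschitz: "\<bar>x_primitive t y - x_primitive t x\<bar> \<le> B * \<bar>y - x\<bar>"
  unfolding x_primitive_def zero_ereal_def by (rule lipschitz_primitive[OF e_loc e_bound])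

lemma x_primitive_continuous: "continuous_on S (x_primitive t)"
  using x_primitive_lipschitz by (rule lipschitz_continuous_on)

lemma x_primitive_init: "x_primitive 0 x = x"
proof -
  have "x_primitive 0 x = (LBINT y=ereal 0..ereal x. 1)"
    unfolding x_primitive_def zero_ereal_def interval_lebesgue_integral_def set_lebesgue_integral_def
    by (intro if_cong refl arg_cong[of _ _ uminus] integral_cong_AE) (use e_init in auto)
  also have "\<dots> = x"
    using interval_integral_FTC_finite[of 0 x "\<lambda>_. 1" "\<lambda>y. y"]
    by (simp add: zero_ereal_def has_real_derivative_iff_has_vector_derivative[symmetric])
  finally show ?thesis .
qed

lemma t_primitive_diff: "t_primitive x t - t_primitive x s = (LBINT z=s..t. f (x, z))"
  unfolding t_primitive_def zero_ereal_def by (rule primitive_diff[OF f_loc])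

lemma t_primitive_lipschitz: "\<bar>t_primitive x t - t_primitive x s\<bar> \<le> B * \<bar>t - s\<bar>"
  unfolding t_primitive_def zero_ereal_def by (rule lipschitz_primitive[OF f_loc f_bound])

lemma t_primitive_init: "t_primitive x 0 = 0" by (simp add: t_primitive_def zero_ereal_def[symmetric])

lemma t_primitive_bound: "\<bar>t_primitive x t\<bar> \<le> B * \<bar>t\<bar>"
  using t_primitive_lipschitz[of x t 0] by (simp add: t_primitive_init)

text \<open>Joint measurability is what Fubini needs when \<open>t_primitive\<close> meets a test
  function. It follows by viewing the function as a partial integral of a Borel function of ((x, t),
  s), cut off to 0 < s \<le> t.\<close>

lemma t_primitive_borel: "(\<lambda>p. t_primitive (fst p) (max 0 (snd p))) \<in> borel_measurable borel"
proof -
  define h where "h q = indicator {q :: (real \<times> real) \<times> real. 0 < snd q \<and> snd q \<le> snd (fst q)} q * f (fst (fst q), snd q)" for q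
  have [measurable]: "(\<lambda>q :: (real \<times> real) \<times> real. f (fst (fst q), snd q)) \<in> borel_measurable borel"
    by (rule measurable_compose[OF borel_measurable_continuous_onI f_borel]) (intro continuous_intros)
  have [measurable]: "(snd :: (real \<times> real) \<times> real \<Rightarrow> real) \<in> borel_measurable borel"
     "(\<lambda>q :: (real \<times> real) \<times> real. snd (fst q)) \<in> borel_measurable borel"
    by (rule borel_measurable_continuous_onI, intro continuous_intros)+
  have "h \<in> borel_measurable borel"
    unfolding h_def by measurable
  then have "(\<lambda>(p, s). h (p, s)) \<in> borel_measurable (borel \<Otimes>\<^sub>M lborel)"
    by (simp cong: measurable_cong_sets) (simp add: borel_prod)
  then have "(\<lambda>p. LINT s|lborel. h (p, s)) \<in> borel_measurable borel"
    by (rule lborel.borel_measurable_lebesgue_integral)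
  moreover have "(LINT s|lborel. h (p, s)) = t_primitive (fst p) (max 0 (snd p))" for p
  proof -
    define r where "r = max 0 (snd p)"
    have "h (p, s) = indicator {0<..r} s *\<^sub>R f (fst p, s)" for s
      by (auto simp: h_def r_def indicator_def)
    moreover have "0 \<le> r" by (simp add: r_def)
    ultimately show ?thesis
      unfolding r_def[symmetric] by (simp add: t_primitive_def zero_ereal_def interval_integral_Ioc set_lebesgue_integral_def)
  qed
  ultimately show ?thesis by simp
qed

lemma t_primitive_loc: "0 \<le> t \<Longrightarrow> loc_bounded (\<lambda>x. t_primitive x t)"
  using borel_slice(1)[OF t_primitive_borel, of t] by (intro loc_boundedI[OF _ t_primitive_bound]) simp

lemma defect_loc: "0 \<le> t \<Longrightarrow> loc_bounded (\<lambda>x. x + t_primitive x t - x_primitive t x)"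
  by (intro loc_bounded_diff loc_bounded_add t_primitive_loc loc_bounded_continuous x_primitive_continuous continuous_on_id)

lemma defect_mean:
  assumes t: "0 \<le> t" and pq: "p \<le> q"
  shows "(LBINT x=p..q. x + t_primitive x t - x_primitive t x) = (q - p) * offset t"
proof -
  \<comment> \<open>As \<open>e 0\<close> is 1 almost everywhere, x is its primitive; this brings
    the integrand into the form of \<open>balance\<close>.\<close>
  have eq: "x + t_primitive x t - x_primitive t x = t_primitive x t - (LBINT y=0..x. e t y - e 0 y)" for x
  proof -
    have "(LBINT y=0..x. e t y - e 0 y) = x_primitive t x - x_primitive 0 x"
      unfolding x_primitive_def zero_ereal_def
      by (intro interval_lebesgue_integral_diff(2) loc_bounded_interval_integrable e_loc)
    then show ?thesis by (simp add: x_primitive_init)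
  qed
  \<comment> \<open>The averaged du Bois-Reymond identity for [p, q] against [0, 1], the reference
    interval in \<open>offset\<close>.\<close>
  have "(1 - 0) * (LBINT x=p..q. x + t_primitive x t - x_primitive t x) = (q - p) * (LBINT x=0..1. x + t_primitive x t - x_primitive t x)"
    unfolding zero_ereal_def one_ereal_def
  proof (rule du_bois_reymond[OF defect_loc[OF t], where l="min p 0 - 1"])
    show "(LINT x|lborel. (x + t_primitive x t - x_primitive t x) * deriv a x) = 0"
      if "smooth_on UNIV a" "\<And>x. x \<notin> {c..d} \<Longrightarrow> a x = 0" for a c d
      using balance[where c=c and d=d, OF t that] unfolding eq unfolding t_primitive_def .
  qed (use pq in \<open>auto simp: min_def\<close>)
  then show ?thesis by (simp add: offset_def)
qed

text \<open>This is how the agreement of \<open>position\<close> with x + M almost everywhere is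
  expressed: zero integral over each interval, which is exactly what an integration by parts
  consumes.\<close>

lemma position_defect_zero:
  fixes p q :: real
  assumes t: "0 \<le> t"
  shows "(LBINT x=p..q. position (x, t) - (x + t_primitive x t)) = 0"
proof -
  have *: "(LBINT x=p..q. position (x, t) - (x + t_primitive x t)) = 0" if "p \<le> q" for p q :: real
  proof -
    have "(LBINT x=p..q. position (x, t) - (x + t_primitive x t)) = (LBINT x=p..q. offset t - (x + t_primitive x t - x_primitive t x))"
      using t by (intro interval_integral_cong) (simp add: position_def)
    also have "\<dots> = (LBINT x=p..q. offset t) - (LBINT x=p..q. x + t_primitive x t - x_primitive t x)"
      by (intro interval_lebesgue_integral_diff(2) loc_bounded_interval_integrable defect_loc t
          loc_bounded_continuous continuous_on_const)
    finally show ?thesis by (simp add: interval_integral_const defect_mean[OF t that])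
  qed
  show ?thesis
  proof (cases "p \<le> q")
    case False
    then show ?thesis by (subst interval_integral_endpoints_reverse) (simp add: *)
  qed (rule *)
qed

text \<open>The right side does not depend on x, so L1 continuity in time becomes continuity of the
  primitive, uniformly on bounded x-intervals.\<close>

lemma x_primitive_time_bound:
  assumes "\<bar>x\<bar> \<le> R"
  shows "\<bar>x_primitive s x - x_primitive t x\<bar> \<le> (LINT y:{-R..R}|lborel. \<bar>e s y - e t y\<bar>)"
proof -
  have l: "loc_bounded (\<lambda>y. \<bar>e s y - e t y\<bar>)"
  proof (rule loc_boundedI[where B="2 * B"])
    show "\<bar>\<bar>e s y - e t y\<bar>\<bar> \<le> 2 * B" for y using e_bound[of s y] e_bound[of t y] by linarith
  qed simp
  have I: "integrable lborel (\<lambda>y. indicator {-R..R} y *\<^sub>R \<bar>e s y - e t y\<bar>)"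
    using loc_bounded_set_integrable[OF l] unfolding set_integrable_def .
  have "x_primitive s x - x_primitive t x = (LBINT y=0..x. e s y - e t y)"
    unfolding x_primitive_def zero_ereal_def
    by (intro interval_lebesgue_integral_diff(2)[symmetric] loc_bounded_interval_integrable e_loc)
  also have "\<bar>\<dots>\<bar> \<le> (LINT y|lborel. \<bar>indicator {min 0 x<..<max 0 x} y *\<^sub>R (e s y - e t y)\<bar>)"
    using integral_norm_bound[of lborel "\<lambda>y. indicator {min 0 x<..<max 0 x} y *\<^sub>R (e s y - e t y)"]
    by (auto simp: interval_lebesgue_integral_def zero_ereal_def set_lebesgue_integral_def min_def max_def)
  also have "\<dots> \<le> (LINT y|lborel. indicator {-R..R} y *\<^sub>R \<bar>e s y - e t y\<bar>)"
    by (rule integral_mono'[OF I]) (use assms in \<open>auto simp: indicator_def\<close>)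
  finally show ?thesis by (simp add: set_lebesgue_integral_def)
qed

lemma x_primitive_time_continuous: "continuous_on {0..} (\<lambda>t. x_primitive t x)"
  unfolding continuous_on_def
proof
  fix t :: real assume "t \<in> {0..}"
  then have "((\<lambda>s. LINT y:{-\<bar>x\<bar>..\<bar>x\<bar>}|lborel. \<bar>e s y - e t y\<bar>) \<longlongrightarrow> 0) (at t within {0..})"
    by (intro e_cont) simp
  then have "((\<lambda>s. x_primitive s x - x_primitive t x) \<longlongrightarrow> 0) (at t within {0..})"
    by (rule Lim_null_comparison[rotated]) (use x_primitive_time_bound in simp)
  then show "((\<lambda>t. x_primitive t x) \<longlongrightarrow> x_primitive t x) (at t within {0..})" by (simp add: LIM_zero_iff)
qed

lemma offset_continuous: "continuous_on {0..} offset"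
  unfolding continuous_on_def
proof
  fix t :: real assume t: "t \<in> {0..}"
  \<comment> \<open>The integrand of \<open>offset\<close> changes by at most B |s - t| through
    \<open>t_primitive\<close> and by the L1 distance of the slices through
    \<open>x_primitive\<close>; R = 1 suffices for a mean over [0, 1].\<close>
  define b where "b s = B * \<bar>s - t\<bar> + (LINT y:{-1..1}|lborel. \<bar>e s y - e t y\<bar>)" for s
  have "(b \<longlongrightarrow> B * \<bar>t - t\<bar> + 0) (at t within {0..})"
    unfolding b_def using t by (intro tendsto_intros e_cont) simp
  then have b: "(b \<longlongrightarrow> 0) (at t within {0..})" by simp
  have bd: "\<bar>offset s - offset t\<bar> \<le> b s" if s: "0 \<le> s" for s
  proof -
    have b0: "0 \<le> b s"
      unfolding b_def using B_nonneg by (auto simp: set_lebesgue_integral_def intro!: add_nonneg_nonneg integral_nonneg)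
    have "offset s - offset t = (LBINT x=ereal 0..ereal 1. (x + t_primitive x s - x_primitive s x) - (x + t_primitive x t - x_primitive t x))"
      unfolding offset_def zero_ereal_def one_ereal_def using t s
      by (intro interval_lebesgue_integral_diff(2)[symmetric] loc_bounded_interval_integrable defect_loc) auto
    also have "\<bar>\<dots>\<bar> \<le> b s * (1 - 0)"
    proof (rule interval_integral_bound)
      fix x :: real assume x: "0 < x" "x < 1"
      show "\<bar>(x + t_primitive x s - x_primitive s x) - (x + t_primitive x t - x_primitive t x)\<bar> \<le> b s"
        using t_primitive_lipschitz[of x s t] x_primitive_time_bound[of x 1 s t] x unfolding b_def by linarith
    qed (use b0 in auto)
    finally show ?thesis by simp
  qed
  have "((\<lambda>s. offset s - offset t) \<longlongrightarrow> 0) (at t within {0..})"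
    by (rule Lim_null_comparison[OF _ b]) (use bd in \<open>auto simp: eventually_at_filter\<close>)
  then show "(offset \<longlongrightarrow> offset t) (at t within {0..})" by (simp add: LIM_zero_iff)
qed

lemma offset_init: "offset 0 = 0"
  by (simp add: offset_def t_primitive_init x_primitive_init)

lemma position_init: "position (x, 0) = x"
  by (simp add: position_def x_primitive_init offset_init)

text \<open>Joint continuity comes from a Lipschitz bound in x that is uniform in time, together
  with continuity in time at one fixed x.\<close>

lemma position_continuous: "continuous_on UNIV position"
proof -
  have "continuous_on UNIV (\<lambda>p. x_primitive (max 0 (snd p)) (fst p))"
    unfolding continuous_on_def
  proof
    fix p :: "real \<times> real"
    obtain x t where p: "p = (x, t)" by (cases p)
    have c: "continuous_on UNIV (\<lambda>s. x_primitive (max 0 s) x)"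
      by (rule continuous_on_compose2[OF x_primitive_time_continuous]) (auto intro!: continuous_intros)
    have "continuous_on UNIV (\<lambda>q::real\<times>real. B * \<bar>fst q - x\<bar> + \<bar>x_primitive (max 0 (snd q)) x - x_primitive (max 0 t) x\<bar>)"
      by (intro continuous_intros continuous_on_compose2[OF c]) auto
    then have "((\<lambda>q. B * \<bar>fst q - x\<bar> + \<bar>x_primitive (max 0 (snd q)) x - x_primitive (max 0 t) x\<bar>) \<longlongrightarrow>
        B * \<bar>fst p - x\<bar> + \<bar>x_primitive (max 0 (snd p)) x - x_primitive (max 0 t) x\<bar>) (at p)"
      unfolding continuous_on_def by blast
    then have "((\<lambda>q. B * \<bar>fst q - x\<bar> + \<bar>x_primitive (max 0 (snd q)) x - x_primitive (max 0 t) x\<bar>) \<longlongrightarrow> 0) (at p)"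
      by (simp add: p)
    moreover have "\<forall>\<^sub>F q in at p. norm (x_primitive (max 0 (snd q)) (fst q) - x_primitive (max 0 t) x)
        \<le> B * \<bar>fst q - x\<bar> + \<bar>x_primitive (max 0 (snd q)) x - x_primitive (max 0 t) x\<bar>"
    proof (intro always_eventually allI)
      fix q :: "real \<times> real"
      show "norm (x_primitive (max 0 (snd q)) (fst q) - x_primitive (max 0 t) x) \<le> B * \<bar>fst q - x\<bar> + \<bar>x_primitive (max 0 (snd q)) x - x_primitive (max 0 t) x\<bar>"
        unfolding real_norm_def using x_primitive_lipschitz[of "max 0 (snd q)" "fst q" x] by linarith
    qed
    ultimately have "((\<lambda>q. x_primitive (max 0 (snd q)) (fst q) - x_primitive (max 0 t) x) \<longlongrightarrow> 0) (at p)"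
      by (rule Lim_null_comparison[rotated])
    then show "((\<lambda>p. x_primitive (max 0 (snd p)) (fst p)) \<longlongrightarrow> x_primitive (max 0 (snd p)) (fst p)) (at p)"
      unfolding p fst_conv snd_conv by (rule LIM_zero_cancel)
  qed
  moreover have "continuous_on UNIV (\<lambda>p::real\<times>real. offset (max 0 (snd p)))"
    by (rule continuous_on_compose2[OF offset_continuous]) (auto intro!: continuous_intros)
  ultimately show ?thesis unfolding position_def by (intro continuous_on_add)
qed

text \<open>At each fixed t > 0 this is an integration by parts in x with the slice
  \<open>e t\<close>; the planar version \<open>U\<close> replaces the slices only after integrating
  in time.\<close>

lemma weak_dx:
  assumes U[measurable]: "U \<in> borel_measurable borel" and UB: "\<And>p. \<bar>U p\<bar> \<le> B"
    and ae: "AE t in lborel. t > 0 \<longrightarrow> (AE x in lborel. e t x = U (x, t))"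
    and \<phi>: "smooth_test \<phi>"
  shows "(LINT p|lborel. position p * dx \<phi> p) = - (LINT p|lborel. U p * \<phi> p)"
proof -
  obtain a b c d C where c: "0 < c" and C: "0 \<le> C"
    and z: "\<And>x t. x \<notin> {a..b} \<or> t \<notin> {c..d} \<Longrightarrow> \<phi> (x, t) = 0 \<and> dx \<phi> (x, t) = 0 \<and> dt \<phi> (x, t) = 0"
    and bd: "\<And>p. \<bar>\<phi> p\<bar> \<le> C" "\<And>p. \<bar>dx \<phi> p\<bar> \<le> C" "\<And>p. \<bar>dt \<phi> p\<bar> \<le> C"
    and cont: "continuous_on UNIV \<phi>" "continuous_on UNIV (dx \<phi>)"
    and D: "\<And>x t. ((\<lambda>x. \<phi> (x, t)) has_real_derivative dx \<phi> (x, t)) (at x)"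
    by (rule smooth_test_facts[OF \<phi>]) blast
  have [measurable]: "\<phi> \<in> borel_measurable borel" using cont(1) by (rule borel_measurable_continuous_onI)
  have c1: "continuous_on UNIV (\<lambda>p. position p * dx \<phi> p)" by (intro continuous_on_mult position_continuous cont)
  have z1: "position (x, t) * dx \<phi> (x, t) = 0" if "x \<notin> {a..b} \<or> t \<notin> {c..d}" for x t using z[OF that] by simp
  obtain C1 where C1: "\<And>p. \<bar>position p * dx \<phi> p\<bar> \<le> C1" using bounded_if_zero_off_box[OF c1 z1] by blast
  note F1 = fubini_box[OF borel_measurable_continuous_onI[OF c1] C1 z1]
  have m2: "(\<lambda>p. U p * \<phi> p) \<in> borel_measurable borel" by simp
  have b2: "\<bar>U p * \<phi> p\<bar> \<le> B * C" for p unfolding abs_mult by (intro mult_mono UB bd B_nonneg) simp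
  have z2: "U (x, t) * \<phi> (x, t) = 0" if "x \<notin> {a..b} \<or> t \<notin> {c..d}" for x t using z[OF that] by simp
  note F2 = fubini_box[OF m2 b2 z2]
  have "(LINT t|lborel. LINT x|lborel. position (x, t) * dx \<phi> (x, t)) = (LINT t|lborel. - (LINT x|lborel. U (x, t) * \<phi> (x, t)))"
  proof (rule integral_cong_AE)
    show "(\<lambda>t. LINT x|lborel. position (x, t) * dx \<phi> (x, t)) \<in> borel_measurable lborel" using F1(5) by simp
    show "(\<lambda>t. - (LINT x|lborel. U (x, t) * \<phi> (x, t))) \<in> borel_measurable lborel" using F2(5) by simp
    show "AE t in lborel. (LINT x|lborel. position (x, t) * dx \<phi> (x, t)) = - (LINT x|lborel. U (x, t) * \<phi> (x, t))"
      using ae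
    proof (rule AE_mp, intro AE_I2 impI)
      fix t :: real assume *: "0 < t \<longrightarrow> (AE x in lborel. e t x = U (x, t))"
      show "(LINT x|lborel. position (x, t) * dx \<phi> (x, t)) = - (LINT x|lborel. U (x, t) * \<phi> (x, t))"
      proof (cases "t > 0")
        case False
        then show ?thesis using z[of _ t] c by simp
      next
        case True
        have cs: "continuous_on UNIV (\<lambda>x. dx \<phi> (x, t))"
          by (intro continuous_on_compose2[OF cont(2)] continuous_intros) auto
        have "(LINT x|lborel. position (x, t) * dx \<phi> (x, t)) = - (LINT x|lborel. e t x * \<phi> (x, t))"
          by (rule integral_by_parts_primitive[OF e_loc _ D cs, of a b])
             (use z True in \<open>auto simp: position_def x_primitive_diff\<close>)
        also have "(LINT x|lborel. e t x * \<phi> (x, t)) = (LINT x|lborel. U (x, t) * \<phi> (x, t))"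
          by (rule integral_cong_AE)
             (use * True borel_slice(1)[OF U] borel_slice(1)[of \<phi>] in auto)
        finally show ?thesis .
      qed
    qed
  qed
  then show ?thesis using F1(3) F2(3) by simp
qed

text \<open>\<open>position\<close> is not visibly a primitive in time, but x + M is. The two are
  interchanged inside the x-integral at each fixed t, and then the order of integration is reversed
  so that the integration by parts in t happens at fixed x.\<close>

lemma weak_dt:
  assumes \<phi>: "smooth_test \<phi>"
  shows "(LINT p|lborel. position p * dt \<phi> p) = - (LINT p|lborel. f p * \<phi> p)"
proof -
  obtain a b c d C where c: "0 < c" and C: "0 \<le> C"
    and z: "\<And>x t. x \<notin> {a..b} \<or> t \<notin> {c..d} \<Longrightarrow> \<phi> (x, t) = 0 \<and> dx \<phi> (x, t) = 0 \<and> dt \<phi> (x, t) = 0"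
    and bd: "\<And>p. \<bar>\<phi> p\<bar> \<le> C" "\<And>p. \<bar>dx \<phi> p\<bar> \<le> C" "\<And>p. \<bar>dt \<phi> p\<bar> \<le> C"
    and cont: "continuous_on UNIV \<phi>" "continuous_on UNIV (dt \<phi>)" "continuous_on UNIV (dx (dt \<phi>))"
    and D: "\<And>x t. ((\<lambda>t. \<phi> (x, t)) has_real_derivative dt \<phi> (x, t)) (at t)"
      "\<And>x t. ((\<lambda>x. dt \<phi> (x, t)) has_real_derivative dx (dt \<phi>) (x, t)) (at x)"
    by (rule smooth_test_facts[OF \<phi>]) blast
  have [measurable]: "\<phi> \<in> borel_measurable borel" "dt \<phi> \<in> borel_measurable borel"
    using cont by (auto intro: borel_measurable_continuous_onI)
  have c1: "continuous_on UNIV (\<lambda>p. position p * dt \<phi> p)" by (intro continuous_on_mult position_continuous cont)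
  have z1: "position (x, t) * dt \<phi> (x, t) = 0" if "x \<notin> {a..b} \<or> t \<notin> {c..d}" for x t using z[OF that] by simp
  obtain C1 where C1: "\<And>p. \<bar>position p * dt \<phi> p\<bar> \<le> C1" using bounded_if_zero_off_box[OF c1 z1] by blast
  note F1 = fubini_box[OF borel_measurable_continuous_onI[OF c1] C1 z1]
  have m2: "(\<lambda>p. f p * \<phi> p) \<in> borel_measurable borel" by simp
  have b2: "\<bar>f p * \<phi> p\<bar> \<le> B * C" for p unfolding abs_mult by (intro mult_mono f_bound bd B_nonneg) simp
  have z2: "f (x, t) * \<phi> (x, t) = 0" if "x \<notin> {a..b} \<or> t \<notin> {c..d}" for x t using z[OF that] by simp
  note F2 = fubini_box[OF m2 b2 z2]
  define h where "h p = (fst p + t_primitive (fst p) (max 0 (snd p))) * dt \<phi> p" for p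
  have m3: "h \<in> borel_measurable borel"
    unfolding h_def using t_primitive_borel borel_fst_snd(1)[of "\<lambda>x. x"] by simp
  have z3: "h (x, t) = 0" if "x \<notin> {a..b} \<or> t \<notin> {c..d}" for x t using z[OF that] by (simp add: h_def)
  have b3: "\<bar>h p\<bar> \<le> (\<bar>a\<bar> + \<bar>b\<bar> + B * \<bar>d\<bar>) * C" for p
  proof (cases "fst p \<in> {a..b} \<and> snd p \<in> {c..d}")
    case True
    have "\<bar>t_primitive (fst p) (max 0 (snd p))\<bar> \<le> B * \<bar>max 0 (snd p)\<bar>" by (rule t_primitive_bound)
    also have "\<dots> \<le> B * \<bar>d\<bar>" using True c by (intro mult_left_mono B_nonneg) auto
    finally have "\<bar>fst p + t_primitive (fst p) (max 0 (snd p))\<bar> \<le> \<bar>a\<bar> + \<bar>b\<bar> + B * \<bar>d\<bar>" using True by auto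
    then show ?thesis unfolding h_def abs_mult by (intro mult_mono bd) (use B_nonneg in auto)
  next
    case False
    then have "h p = 0" using z3[of "fst p" "snd p"] by auto
    then show ?thesis using B_nonneg C by simp
  qed
  note F3 = fubini_box[OF m3 b3 z3]
  have "(LINT x|lborel. position (x, t) * dt \<phi> (x, t)) = (LINT x|lborel. h (x, t))" for t
  proof (cases "t > 0")
    case False
    then show ?thesis using z[of _ t] c by (simp add: h_def)
  next
    case True
    have cs: "continuous_on UNIV (\<lambda>x. dx (dt \<phi>) (x, t))" "continuous_on UNIV (\<lambda>x. dt \<phi> (x, t))"
        "continuous_on UNIV (\<lambda>x. position (x, t))"
      by (intro continuous_on_compose2[OF cont(3)] continuous_on_compose2[OF cont(2)]
          continuous_on_compose2[OF position_continuous] continuous_intros; simp)+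
    have W: "loc_bounded (\<lambda>x. position (x, t) - (x + t_primitive x t))"
      using True by (intro loc_bounded_diff loc_bounded_add t_primitive_loc loc_bounded_continuous cs continuous_on_id) auto
    have zt: "dt \<phi> (x, t) = 0" if "x \<notin> {a..b}" for x using z that by blast
    \<comment> \<open>The defect has integral 0 over each interval, so the zero function is a
      primitive of it. Integrating by parts with that primitive shows that the defect annihilates
      \<open>dt \<phi>\<close> at time t.\<close>
    have "(LINT x|lborel. 0 * dx (dt \<phi>) (x, t)) = - (LINT x|lborel. (position (x, t) - (x + t_primitive x t)) * dt \<phi> (x, t))"
      by (rule integral_by_parts_primitive[OF W _ D(2) cs(1) zt])
         (use position_defect_zero[of t] True in auto)
    then have "(LINT x|lborel. (position (x, t) - (x + t_primitive x t)) * dt \<phi> (x, t)) = 0" by simp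
    moreover have I: "integrable lborel (\<lambda>x. g x * dt \<phi> (x, t))" if g: "loc_bounded g" for g
    proof -
      have "loc_bounded (\<lambda>x. g x * dt \<phi> (x, t))" by (intro loc_bounded_mult g loc_bounded_continuous cs)
      from loc_bounded_set_integrable[OF this, of a b]
      have "integrable lborel (\<lambda>x. indicator {a..b} x *\<^sub>R (g x * dt \<phi> (x, t)))" unfolding set_integrable_def .
      moreover have "indicator {a..b} x *\<^sub>R (g x * dt \<phi> (x, t)) = g x * dt \<phi> (x, t)" for x
        using zt[of x] by (cases "x \<in> {a..b}") auto
      ultimately show ?thesis by (simp only:)
    qed
    have "(LINT x|lborel. (position (x, t) - (x + t_primitive x t)) * dt \<phi> (x, t)) =
        (LINT x|lborel. position (x, t) * dt \<phi> (x, t)) - (LINT x|lborel. (x + t_primitive x t) * dt \<phi> (x, t))"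
      unfolding left_diff_distrib
      by (rule Bochner_Integration.integral_diff[OF I[OF loc_bounded_continuous[OF cs(3)]] I])
         (use True in \<open>intro loc_bounded_add t_primitive_loc loc_bounded_continuous continuous_on_id, simp\<close>)
    ultimately show ?thesis using True by (simp add: h_def)
  qed
  then have "(LINT p|lborel. position p * dt \<phi> p) = (LINT p|lborel. h p)" using F1(3) F3(3) by simp
  moreover have "(LINT t|lborel. h (x, t)) = - (LINT t|lborel. f (x, t) * \<phi> (x, t))" for x
  proof -
    have cs: "continuous_on UNIV (\<lambda>t. dt \<phi> (x, t))"
      by (intro continuous_on_compose2[OF cont(2)] continuous_intros) auto
    have zt: "\<phi> (x, t) = 0" if "t \<notin> {c..d}" for t using z that by blast
    \<comment> \<open>On the support interval [c, d] one has t \<ge> c > 0, so the clipping is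
      invisible.\<close>
    have "(LINT t|lborel. (x + t_primitive x (max 0 t)) * dt \<phi> (x, t)) = - (LINT t|lborel. f (x, t) * \<phi> (x, t))"
      by (rule integral_by_parts_primitive[OF f_loc _ D(1) cs zt])
         (use c in \<open>auto simp: t_primitive_diff\<close>)
    then show ?thesis by (simp add: h_def)
  qed
  ultimately show ?thesis using F3(2) F2(2) by simp
qed

end

section \<open>Borel representatives and the theorem\<close>

lemma set_lebesgue_integral_borel_version:
  fixes g h :: "real \<Rightarrow> real"
  assumes "h \<in> borel_measurable borel" "AE x in lborel. g x = h x"
  shows "(LINT x:{c..d}|lebesgue. g x) = (LINT x:{c..d}|lborel. h x)"
proof -
  have m: "(\<lambda>x. indicator {c..d} x *\<^sub>R h x) \<in> borel_measurable lborel" using assms(1) by simp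
  then have m': "(\<lambda>x. indicator {c..d} x *\<^sub>R h x) \<in> borel_measurable lebesgue" by (rule measurable_completion)
  have "AE x in lborel. indicator {c..d} x *\<^sub>R h x = indicator {c..d} x *\<^sub>R g x"
    using assms(2) by eventually_elim simp
  then have ae: "AE x in lebesgue. indicator {c..d} x *\<^sub>R h x = indicator {c..d} x *\<^sub>R g x"
    by (rule AE_completion)
  have "(LINT x:{c..d}|lebesgue. g x) = (LINT x|lebesgue. indicator {c..d} x *\<^sub>R h x)"
    unfolding set_lebesgue_integral_def
    by (rule integral_cong_AE[OF m' borel_measurable_AE[OF m' ae] ae, symmetric])
  also have "\<dots> = (LINT x:{c..d}|lborel. h x)"
    unfolding set_lebesgue_integral_def by (rule integral_completion[OF m])
  finally show ?thesis .
qed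

text \<open>Planar measurability yields measurable slices for almost every time only; local
  integrability yields them at each time.\<close>

lemma measurable_if_absolutely_integrable_intervals:
  fixes g :: "real \<Rightarrow> real"
  assumes "\<And>c d. g absolutely_integrable_on {c..d}"
  shows "g \<in> borel_measurable lebesgue"
proof (rule borel_measurable_LIMSEQ_real)
  fix n :: nat
  show "(\<lambda>x. indicator {- real n..real n} x *\<^sub>R g x) \<in> borel_measurable lebesgue"
    using assms[of "- real n" "real n"] unfolding set_integrable_def by (rule borel_measurable_integrable)
next
  fix x :: real
  obtain N where N: "\<bar>x\<bar> < real N" using reals_Archimedean2 by blast
  have "\<forall>\<^sub>F n in sequentially. indicator {- real n..real n} x *\<^sub>R g x = g x"
    using eventually_ge_at_top[of N]
  proof eventually_elim
    case (elim n)
    then have "\<bar>x\<bar> \<le> real n" using N by linarith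
    then have "x \<in> {- real n..real n}" by (auto simp: abs_le_iff)
    then show ?case by simp
  qed
  then show "(\<lambda>n. indicator {- real n..real n} x *\<^sub>R g x) \<longlonglongrightarrow> g x" by (rule tendsto_eventually)
qed

lemma borel_slices:
  fixes g :: "real \<times> real \<Rightarrow> real"
  assumes gB: "\<And>p. p \<in> closed_half_plane \<Longrightarrow> \<bar>g p\<bar> \<le> B" and L: "L1loc_continuous_on {0..} g" and B0: "0 \<le> B"
  obtains e where "\<And>t. e t \<in> borel_measurable borel" "\<And>t x. \<bar>e t x\<bar> \<le> B"
    "\<And>t. 0 \<le> t \<Longrightarrow> AE x in lborel. g (x, t) = e t x"
    "\<And>t c d. 0 \<le> t \<Longrightarrow> ((\<lambda>s. LINT x:{c..d}|lborel. \<bar>e s x - e t x\<bar>) \<longlongrightarrow> 0) (at t within {0..})"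
proof -
  have "\<exists>h. h \<in> borel_measurable borel \<and> (\<forall>x. \<bar>h x\<bar> \<le> B) \<and> (0 \<le> t \<longrightarrow> (AE x in lborel. g (x, t) = h x))" for t
  proof (cases "0 \<le> t")
    case True
    have "(\<lambda>x. g (x, t)) \<in> borel_measurable lebesgue"
      by (rule measurable_if_absolutely_integrable_intervals) (use L True in \<open>auto simp: L1loc_continuous_on_def\<close>)
    from bounded_borel_version[OF this, of B] show ?thesis using gB True by auto
  next
    case False
    then show ?thesis using B0 by (intro exI[of _ "\<lambda>_. 0"]) auto
  qed
  then obtain e where e: "\<And>t. e t \<in> borel_measurable borel" "\<And>t x. \<bar>e t x\<bar> \<le> B"
    "\<And>t. 0 \<le> t \<Longrightarrow> AE x in lborel. g (x, t) = e t x"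
    by metis
  have "((\<lambda>s. LINT x:{c..d}|lborel. \<bar>e s x - e t x\<bar>) \<longlongrightarrow> 0) (at t within {0..})" if t: "0 \<le> t" for t c d
  proof (rule Lim_transform_eventually)
    show "((\<lambda>s. LINT x:{c..d}|lebesgue. \<bar>g (x, s) - g (x, t)\<bar>) \<longlongrightarrow> 0) (at t within {0..})"
      using L t by (auto simp: L1loc_continuous_on_def)
    have "(LINT x:{c..d}|lebesgue. \<bar>g (x, s) - g (x, t)\<bar>) = (LINT x:{c..d}|lborel. \<bar>e s x - e t x\<bar>)" if "0 \<le> s" for s
    proof (rule set_lebesgue_integral_borel_version)
      show "AE x in lborel. \<bar>g (x, s) - g (x, t)\<bar> = \<bar>e s x - e t x\<bar>"
        using e(3)[OF that] e(3)[OF t] by eventually_elim simp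
    qed (use e(1) in simp)
    then show "\<forall>\<^sub>F s in at t within {0..}. (LINT x:{c..d}|lebesgue. \<bar>g (x, s) - g (x, t)\<bar>) = (LINT x:{c..d}|lborel. \<bar>e s x - e t x\<bar>)"
      by (auto simp: eventually_at_filter)
  qed
  with e show ?thesis by (rule that)
qed

lemma borel_half_plane_version:
  fixes g :: "real \<times> real \<Rightarrow> real"
  assumes gB: "\<And>p. p \<in> closed_half_plane \<Longrightarrow> \<bar>g p\<bar> \<le> B" and B0: "0 \<le> B"
    and m: "g \<in> borel_measurable (lebesgue_on closed_half_plane)"
  obtains U where "U \<in> borel_measurable borel" "\<And>p. \<bar>U p\<bar> \<le> B" "AE p in lborel. p \<in> closed_half_plane \<longrightarrow> g p = U p"
proof -
  have "closed (closed_half_plane)" by (intro closed_Times) auto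
  then have S: "closed_half_plane \<in> sets lebesgue" by auto
  have "(\<lambda>p. if p \<in> closed_half_plane then g p else 0) \<in> borel_measurable lebesgue"
    by (rule borel_measurable_if_I[OF m S])
  moreover have "\<bar>if p \<in> closed_half_plane then g p else 0\<bar> \<le> B" for p using gB[of p] B0 by auto
  ultimately obtain U where U: "U \<in> borel_measurable borel" "\<And>p. \<bar>U p\<bar> \<le> B"
    "AE p in lborel. (if p \<in> closed_half_plane then g p else 0) = U p"
    using bounded_borel_version[of "\<lambda>p. if p \<in> closed_half_plane then g p else 0" B] by blast
  have "AE p in lborel. p \<in> closed_half_plane \<longrightarrow> g p = U p"
    using U(3) by eventually_elim auto
  with U(1,2) show ?thesis by (rule that)
qed

text \<open>\<open>e t\<close> and \<open>U\<close> are chosen independently of each other; they are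
  compared through g, whose planar exceptional set has null slices at almost every time.\<close>

lemma slices_of_half_plane_version:
  assumes "AE p in (lborel :: (real \<times> real) measure). p \<in> closed_half_plane \<longrightarrow> g p = U p"
    and "\<And>t. 0 \<le> t \<Longrightarrow> AE x in lborel. g (x, t) = e t x"
  shows "AE t in lborel. 0 < t \<longrightarrow> (AE x in lborel. e t x = U (x, t))"
  using AE_slices[OF assms(1)]
proof eventually_elim
  case (elim t)
  show ?case
  proof
    assume t: "0 < t"
    show "AE x in lborel. e t x = U (x, t)"
      using elim assms(2)[OF less_imp_le[OF t]] by eventually_elim (use t in auto)
  qed
qed

theorem corollary2p3:
  fixes I :: "real set" and \<sigma>\<^sub>0 G G' :: "real \<Rightarrow> real"
    and \<eta> v :: "real \<times> real \<Rightarrow> real"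
  assumes "compact I" and "is_interval I" and "I \<subseteq> {0<..}"
    and "\<And>x. \<sigma>\<^sub>0 x \<in> I" and "bounded_total_variation \<sigma>\<^sub>0"
    and "Ck_on 2 I G"
    and "\<And>\<sigma>. \<sigma> \<in> I \<Longrightarrow> (G has_real_derivative G' \<sigma>) (at \<sigma> within I)"
    and "\<And>\<sigma>. \<sigma> \<in> I \<Longrightarrow> G' \<sigma> > 0"
    and "admissible_weak_solution I G G' (\<lambda>x. 1) \<sigma>\<^sub>0 \<eta> v"
    and "C_BV2 \<eta> v"
  shows "\<exists>\<gamma>. distributional_position G \<eta> v \<gamma> \<and>
           (\<forall>\<gamma>'. distributional_position G \<eta> v \<gamma>' \<longrightarrow> (\<forall>x. \<forall>t\<ge>0. \<gamma>' (x, t) = \<gamma> (x, t))) \<and>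
           (\<forall>t>0. abs_continuous (\<lambda>x. \<gamma> (x, t)) \<and> bij (\<lambda>x. \<gamma> (x, t)) \<and>
                  abs_continuous (inv (\<lambda>x. \<gamma> (x, t))))"
proof -
  have "weak_solution I G (\<lambda>x. 1) \<sigma>\<^sub>0 \<eta> v" using assms(9) by (simp add: admissible_weak_solution_def)
  then have states: "\<And>p. p \<in> closed_half_plane \<Longrightarrow> (\<eta> p, v p) \<in> state_space I"
    and bounded: "bounded ((\<lambda>p. (\<eta> p, v p)) ` closed_half_plane)"
    and meas: "(\<lambda>p. (\<eta> p, v p)) \<in> borel_measurable (lebesgue_on closed_half_plane)"
    and L\<eta>: "L1loc_continuous_on {0..} \<eta>" and Lv: "L1loc_continuous_on {0..} v"
    and init: "AE x in lebesgue. \<eta> (x, 0) = 1 \<and> v (x, 0) = \<sigma>\<^sub>0 x"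
    and weak\<eta>: "\<And>\<phi>. smooth_test \<phi> \<Longrightarrow> (LINT p:half_plane|lebesgue. \<eta> p * dt \<phi> p - G (v p / \<eta> p) * dx \<phi> p) = 0"
    and weakv: "\<And>\<phi>. smooth_test \<phi> \<Longrightarrow> (LINT p:half_plane|lebesgue. v p * dt \<phi> p) = 0"
    unfolding weak_solution_def by blast+
  have state: "0 < \<eta> p" "v p / \<eta> p \<in> I" if "p \<in> closed_half_plane" for p
    using states[OF that] by (auto simp: state_space_def)
  have contG: "continuous_on I G" using assms(7) by (rule DERIV_continuous_on)
  have "I \<noteq> {}" using assms(4) by auto
  obtain m where m: "m \<in> I" "\<And>s. s \<in> I \<Longrightarrow> m \<le> s"
    using compact_attains_inf[OF assms(1) \<open>I \<noteq> {}\<close>] by blast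
  obtain M' where M': "M' \<in> I" "\<And>s. s \<in> I \<Longrightarrow> s \<le> M'"
    using compact_attains_sup[OF assms(1) \<open>I \<noteq> {}\<close>] by blast
  have pos_bounds: "0 < m" "0 < M'" using m(1) M'(1) assms(3) by auto
  obtain b1 where b1: "\<And>p. p \<in> closed_half_plane \<Longrightarrow> norm (\<eta> p, v p) \<le> b1"
    using bounded by (auto simp: bounded_iff)
  obtain b2 where b2: "\<And>s. s \<in> I \<Longrightarrow> \<bar>G s\<bar> \<le> b2"
    using compact_imp_bounded[OF compact_continuous_image[OF contG assms(1)]] by (auto simp: bounded_iff)
  \<comment> \<open>One bound for \<eta>, v and the flux, as
    \<open>conservation_law_integrated\<close> and \<open>position_data\<close> use a single
    constant.\<close>
  define B where "B = \<bar>b1\<bar> + \<bar>b2\<bar>"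
  have B0: "0 \<le> B" by (simp add: B_def)
  have \<eta>B: "\<bar>\<eta> p\<bar> \<le> B" if "p \<in> closed_half_plane" for p
    using b1[OF that] norm_fst_le[of "\<eta> p" "v p"] unfolding B_def real_norm_def by linarith
  have vB: "\<bar>v p\<bar> \<le> B" if "p \<in> closed_half_plane" for p
    using b1[OF that] norm_snd_le[of "v p" "\<eta> p"] unfolding B_def real_norm_def by linarith
  define F where "F p = G (v p / \<eta> p)" for p
  have FB: "\<bar>F p\<bar> \<le> B" if "p \<in> closed_half_plane" for p
    using b2[OF state(2)[OF that]] unfolding B_def F_def by linarith
  have m\<eta>: "\<eta> \<in> borel_measurable (lebesgue_on closed_half_plane)"
    and mv: "v \<in> borel_measurable (lebesgue_on closed_half_plane)"
    using measurable_compose[OF meas borel_measurable_continuous_onI[OF continuous_on_fst[OF continuous_on_id]]]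
      measurable_compose[OF meas borel_measurable_continuous_onI[OF continuous_on_snd[OF continuous_on_id]]] by simp_all
  have mF: "F \<in> borel_measurable (lebesgue_on closed_half_plane)"
  proof -
    have I: "I \<in> sets borel" using assms(1) by (simp add: borel_compact)
    \<comment> \<open>G is controlled on I only, so it is extended by 0 to a Borel function; on the
      closed half plane v/\<eta> lies in I and the extension is not felt.\<close>
    have "(\<lambda>s. if s \<in> I then G s else 0) \<in> borel_measurable borel"
      by (rule borel_measurable_continuous_on_if[OF I contG]) simp
    from measurable_compose[OF borel_measurable_divide[OF mv m\<eta>] this]
    have "(\<lambda>p. if v p / \<eta> p \<in> I then G (v p / \<eta> p) else 0) \<in> borel_measurable (lebesgue_on closed_half_plane)" .
    then show ?thesis
      by (rule measurable_cong[THEN iffD1, rotated]) (use state(2) in \<open>auto simp: F_def\<close>)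
  qed
  obtain e where e: "\<And>t. e t \<in> borel_measurable borel" "\<And>t x. \<bar>e t x\<bar> \<le> B"
    "\<And>t. 0 \<le> t \<Longrightarrow> AE x in lborel. \<eta> (x, t) = e t x"
    "\<And>t c d. 0 \<le> t \<Longrightarrow> ((\<lambda>s. LINT x:{c..d}|lborel. \<bar>e s x - e t x\<bar>) \<longlongrightarrow> 0) (at t within {0..})"
    by (rule borel_slices[OF \<eta>B L\<eta> B0]) blast+
  obtain w where w: "\<And>t. w t \<in> borel_measurable borel" "\<And>t x. \<bar>w t x\<bar> \<le> B"
    "\<And>t. 0 \<le> t \<Longrightarrow> AE x in lborel. v (x, t) = w t x"
    "\<And>t c d. 0 \<le> t \<Longrightarrow> ((\<lambda>s. LINT x:{c..d}|lborel. \<bar>w s x - w t x\<bar>) \<longlongrightarrow> 0) (at t within {0..})"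
    by (rule borel_slices[OF vB Lv B0]) blast+
  obtain U where U: "U \<in> borel_measurable borel" "\<And>p. \<bar>U p\<bar> \<le> B" "AE p in lborel. p \<in> closed_half_plane \<longrightarrow> \<eta> p = U p"
    by (rule borel_half_plane_version[OF \<eta>B B0 m\<eta>]) blast+
  obtain V where V: "V \<in> borel_measurable borel" "\<And>p. \<bar>V p\<bar> \<le> B" "AE p in lborel. p \<in> closed_half_plane \<longrightarrow> v p = V p"
    by (rule borel_half_plane_version[OF vB B0 mv]) blast+
  obtain f where f: "f \<in> borel_measurable borel" "\<And>p. \<bar>f p\<bar> \<le> B" "AE p in lborel. p \<in> closed_half_plane \<longrightarrow> F p = f p"
    by (rule borel_half_plane_version[OF FB B0 mF]) blast+
  have ae_e: "AE t in lborel. 0 < t \<longrightarrow> (AE x in lborel. e t x = U (x, t))"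
    by (rule slices_of_half_plane_version[OF U(3) e(3)])
  have ae_w: "AE t in lborel. 0 < t \<longrightarrow> (AE x in lborel. w t x = V (x, t))"
    by (rule slices_of_half_plane_version[OF V(3) w(3)])
  have test_borel: "\<phi> \<in> borel_measurable borel" "dx \<phi> \<in> borel_measurable borel" "dt \<phi> \<in> borel_measurable borel"
    and test_zero: "\<And>p. p \<notin> half_plane \<Longrightarrow> \<phi> p = 0 \<and> dx \<phi> p = 0 \<and> dt \<phi> p = 0"
    if \<phi>: "smooth_test \<phi>" for \<phi>
  proof -
    obtain a b c d where c: "0 < c"
      and z: "\<And>x t. x \<notin> {a..b} \<or> t \<notin> {c..d} \<Longrightarrow> \<phi> (x, t) = 0 \<and> dx \<phi> (x, t) = 0 \<and> dt \<phi> (x, t) = 0"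
      and cont: "continuous_on UNIV \<phi>" "continuous_on UNIV (dx \<phi>)" "continuous_on UNIV (dt \<phi>)"
      by (rule smooth_test_facts[OF \<phi>]) blast
    show "\<phi> p = 0 \<and> dx \<phi> p = 0 \<and> dt \<phi> p = 0" if "p \<notin> half_plane" for p
      using z[of "fst p" "snd p"] that c by (cases p) auto
    show "\<phi> \<in> borel_measurable borel" "dx \<phi> \<in> borel_measurable borel" "dt \<phi> \<in> borel_measurable borel"
      using cont by (auto intro: borel_measurable_continuous_onI)
  qed
  have balance_e: "(LINT x|lborel. ((LBINT s=0..t. f (x, s)) - (LBINT y=0..x. e t y - e 0 y)) * deriv a x) = 0"
    if t: "0 \<le> t" and a: "smooth_on UNIV a" and az: "\<And>x. x \<notin> {c..d} \<Longrightarrow> a x = 0" for t a c d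
  proof (rule conservation_law_integrated[OF U(1,2) f(1,2) e(1,2) ae_e e(4) _ a az t])
    fix a b :: "real \<Rightarrow> real" and c d c' d' :: real
    assume a: "smooth_on UNIV a" and b: "smooth_on UNIV b" and az: "\<And>x. x \<notin> {c..d} \<Longrightarrow> a x = 0"
      and c': "0 < c'" and bz: "\<And>x. x \<notin> {c'..d'} \<Longrightarrow> b x = 0"
    define \<phi> where "\<phi> = (\<lambda>p::real\<times>real. a (fst p) * b (snd p))"
    have \<phi>: "smooth_test \<phi>" and D: "dx \<phi> p = deriv a (fst p) * b (snd p)" "dt \<phi> p = a (fst p) * deriv b (snd p)" for p
      unfolding \<phi>_def using smooth_test_product[OF a az b bz c'] by auto
    note tb = test_borel[OF \<phi>]
    have "(LINT p:half_plane|lebesgue. \<eta> p * dt \<phi> p - G (v p / \<eta> p) * dx \<phi> p) = (LINT p|lborel. U p * dt \<phi> p - f p * dx \<phi> p)"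
    proof (rule half_plane_integral)
      show "AE p in lborel. p \<in> half_plane \<longrightarrow> \<eta> p * dt \<phi> p - G (v p / \<eta> p) * dx \<phi> p = U p * dt \<phi> p - f p * dx \<phi> p"
        using U(3) f(3) by eventually_elim (auto simp: F_def)
      show "U p * dt \<phi> p - f p * dx \<phi> p = 0" if "p \<notin> half_plane" for p using test_zero[OF \<phi> that] by simp
    qed (use tb U(1) f(1) in simp)
    then show "(LINT p|lborel. U p * (a (fst p) * deriv b (snd p)) - f p * (deriv a (fst p) * b (snd p))) = 0"
      using weak\<eta>[OF \<phi>] by (simp add: D)
  qed
  have balance_w: "(LINT x|lborel. ((LBINT s=0..t. 0) - (LBINT y=0..x. w t y - w 0 y)) * deriv a x) = 0"
    if t: "0 \<le> t" and a: "smooth_on UNIV a" and az: "\<And>x. x \<notin> {c..d} \<Longrightarrow> a x = 0" for t a c d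
  \<comment> \<open>The equation for v is the same conservation law with flux 0.\<close>
  proof (rule conservation_law_integrated[where f="\<lambda>_. 0", OF V(1,2) _ _ w(1,2) ae_w w(4) _ a az t])
    fix a b :: "real \<Rightarrow> real" and c d c' d' :: real
    assume a: "smooth_on UNIV a" and b: "smooth_on UNIV b" and az: "\<And>x. x \<notin> {c..d} \<Longrightarrow> a x = 0"
      and c': "0 < c'" and bz: "\<And>x. x \<notin> {c'..d'} \<Longrightarrow> b x = 0"
    define \<phi> where "\<phi> = (\<lambda>p::real\<times>real. a (fst p) * b (snd p))"
    have \<phi>: "smooth_test \<phi>" and D: "dt \<phi> p = a (fst p) * deriv b (snd p)" for p
      unfolding \<phi>_def using smooth_test_product[OF a az b bz c'] by auto
    note tb = test_borel[OF \<phi>]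
    have "(LINT p:half_plane|lebesgue. v p * dt \<phi> p) = (LINT p|lborel. V p * dt \<phi> p)"
    proof (rule half_plane_integral)
      show "AE p in lborel. p \<in> half_plane \<longrightarrow> v p * dt \<phi> p = V p * dt \<phi> p"
        using V(3) by eventually_elim auto
      show "V p * dt \<phi> p = 0" if "p \<notin> half_plane" for p using test_zero[OF \<phi> that] by simp
    qed (use tb V(1) in simp)
    then show "(LINT p|lborel. V p * (a (fst p) * deriv b (snd p)) - 0 * (deriv a (fst p) * b (snd p))) = 0"
      using weakv[OF \<phi>] by (simp add: D)
  qed (use B0 in auto)
  have init': "AE x in lborel. \<eta> (x, 0) = 1 \<and> v (x, 0) = \<sigma>\<^sub>0 x"
    using init unfolding AE_completion_iff .
  interpret position_data B e f
  proof
    show "AE x in lborel. e 0 x = 1"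
      using init' e(3)[of 0, simplified] by eventually_elim auto
    show "(LINT x|lborel. ((LBINT s=0..t. f (x, s)) - (LBINT y=0..x. e t y - e 0 y)) * deriv a x) = 0"
      if "0 \<le> t" "smooth_on UNIV a" "\<And>x. x \<notin> {c..d} \<Longrightarrow> a x = 0" for t a c d
      using that by (rule balance_e)
  qed (use e f in auto)
  have w_loc: "loc_bounded (w t)" for t using w(1,2) by (rule loc_boundedI)
  have w_const: "(LBINT z=x..y. w t z) = (LBINT z=x..y. w 0 z)" if t: "0 \<le> t" for t x y :: real
  proof -
    \<comment> \<open>With zero flux the balance says that W itself is annihilated by all a'. Being
      continuous, W is constant, and its increments are the differences of the two
      integrals.\<close>
    define W where "W x = (LBINT y=0..x. w t y - w 0 y)" for x :: real
    have wd: "loc_bounded (\<lambda>y. w t y - w 0 y)" by (intro loc_bounded_diff w_loc)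
    have wd2: "\<bar>w t y - w 0 y\<bar> \<le> 2 * B" for y using w(2)[of t y] w(2)[of 0 y] by linarith
    have cW: "continuous_on UNIV W"
      unfolding W_def zero_ereal_def by (rule lipschitz_continuous_on[OF lipschitz_primitive[OF wd wd2]])
    have "W y = W x"
    proof (rule du_bois_reymond_continuous[where l="min x y - 1", OF loc_bounded_continuous[OF cW] continuous_on_subset[OF cW subset_UNIV]])
      show "(LINT x|lborel. W x * deriv a x) = 0"
        if "smooth_on UNIV a" "\<And>x. x \<notin> {c..d} \<Longrightarrow> a x = 0" for a c d
        using balance_w[where c=c and d=d, OF t that] unfolding W_def by simp
    qed (auto simp: min_def)
    then have "(LBINT z=x..y. w t z - w 0 z) = 0"
      using primitive_diff[OF wd, of 0 y x] unfolding W_def zero_ereal_def by simp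
    then show ?thesis
      using interval_lebesgue_integral_diff(2)[OF loc_bounded_interval_integrable[OF w_loc] loc_bounded_interval_integrable[OF w_loc], of x y t 0] by simp
  qed
  \<comment> \<open>Three comparisons combine: m \<le> v at time 0, the interval integrals of v do
    not change in time, and v \<le> M' \<eta> at time t.\<close>
  have lower: "m / M' * (y - x) \<le> x_primitive t y - x_primitive t x" if t: "0 \<le> t" and xy: "x \<le> y" for t x y
  proof -
    have "m * (y - x) = (LBINT z=x..y. m)" by (simp add: interval_integral_const)
    also have "\<dots> \<le> (LBINT z=x..y. w 0 z)"
    proof (rule interval_integral_mono[OF loc_bounded_continuous[OF continuous_on_const] w_loc _ xy])
      show "AE z in lborel. m \<le> w 0 z"
        using init' w(3)[of 0, simplified] by eventually_elim (use m(2) assms(4) in metis)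
    qed
    also have "\<dots> = (LBINT z=x..y. w t z)" by (rule w_const[OF t, symmetric])
    also have "\<dots> \<le> (LBINT z=x..y. M' * e t z)"
    proof (rule interval_integral_mono[OF w_loc loc_bounded_mult[OF loc_bounded_continuous[OF continuous_on_const] e_loc] _ xy])
      show "AE z in lborel. w t z \<le> M' * e t z"
        using w(3)[OF t] e(3)[OF t]
      proof eventually_elim
        case (elim z)
        have "0 < \<eta> (z, t)" "v (z, t) / \<eta> (z, t) \<le> M'" using state[of "(z, t)"] M'(2) t by auto
        then show ?case using elim by (simp add: pos_divide_le_eq)
      qed
    qed
    also have "\<dots> = M' * (LBINT z=x..y. e t z)" by simp
    finally have "m * (y - x) \<le> M' * (x_primitive t y - x_primitive t x)" by (simp add: x_primitive_diff)
    then show ?thesis using pos_bounds by (simp add: field_simps)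
  qed
  have conv_\<eta>: "(LINT p:half_plane|lebesgue. \<eta> p * \<phi> p) = (LINT p|lborel. U p * \<phi> p)"
    and conv_F: "(LINT p:half_plane|lebesgue. G (v p / \<eta> p) * \<phi> p) = (LINT p|lborel. f p * \<phi> p)"
    if \<phi>: "smooth_test \<phi>" for \<phi>
  proof -
    note tb = test_borel[OF \<phi>]
    show "(LINT p:half_plane|lebesgue. \<eta> p * \<phi> p) = (LINT p|lborel. U p * \<phi> p)"
    proof (rule half_plane_integral)
      show "AE p in lborel. p \<in> half_plane \<longrightarrow> \<eta> p * \<phi> p = U p * \<phi> p" using U(3) by eventually_elim auto
      show "U p * \<phi> p = 0" if "p \<notin> half_plane" for p using test_zero[OF \<phi> that] by simp
    qed (use tb U(1) in simp)
    show "(LINT p:half_plane|lebesgue. G (v p / \<eta> p) * \<phi> p) = (LINT p|lborel. f p * \<phi> p)"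
    proof (rule half_plane_integral)
      show "AE p in lborel. p \<in> half_plane \<longrightarrow> G (v p / \<eta> p) * \<phi> p = f p * \<phi> p"
        using f(3) by eventually_elim (auto simp: F_def)
      show "f p * \<phi> p = 0" if "p \<notin> half_plane" for p using test_zero[OF \<phi> that] by simp
    qed (use tb f(1) in simp)
  qed
  \<comment> \<open>Here \<open>\<gamma>'\<close> is a continuous function on the whole plane that
    agrees with \<open>\<gamma>\<close> on the half plane; it serves both \<open>position\<close>
    and the extension of a competing solution.\<close>
  have conv_cont: "(LINT p:half_plane|lebesgue. \<gamma> p * dx \<phi> p) = (LINT p|lborel. \<gamma>' p * dx \<phi> p)"
     "(LINT p:half_plane|lebesgue. \<gamma> p * dt \<phi> p) = (LINT p|lborel. \<gamma>' p * dt \<phi> p)"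
    if \<phi>: "smooth_test \<phi>" and c: "continuous_on UNIV \<gamma>'" and eq: "\<And>p. p \<in> half_plane \<Longrightarrow> \<gamma> p = \<gamma>' p"
    for \<phi> \<gamma> \<gamma>'
  proof -
    note tb = test_borel[OF \<phi>]
    have \<gamma>': "\<gamma>' \<in> borel_measurable borel" using c by (rule borel_measurable_continuous_onI)
    show "(LINT p:half_plane|lebesgue. \<gamma> p * dx \<phi> p) = (LINT p|lborel. \<gamma>' p * dx \<phi> p)"
    proof (rule half_plane_integral)
      show "\<gamma>' p * dx \<phi> p = 0" if "p \<notin> half_plane" for p using test_zero[OF \<phi> that] by simp
    qed (use tb \<gamma>' eq in simp_all)
    show "(LINT p:half_plane|lebesgue. \<gamma> p * dt \<phi> p) = (LINT p|lborel. \<gamma>' p * dt \<phi> p)"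
    proof (rule half_plane_integral)
      show "\<gamma>' p * dt \<phi> p = 0" if "p \<notin> half_plane" for p using test_zero[OF \<phi> that] by simp
    qed (use tb \<gamma>' eq in simp_all)
  qed
  have dist: "distributional_position G \<eta> v position"
    unfolding distributional_position_def
  proof (intro conjI allI impI)
    show "continuous_on closed_half_plane position" using position_continuous continuous_on_subset by blast
    show "position (x, 0) = x" for x by (rule position_init)
    fix \<phi> assume \<phi>: "smooth_test \<phi>"
    show "(LINT p:half_plane|lebesgue. position p * dx \<phi> p) = - (LINT p:half_plane|lebesgue. \<eta> p * \<phi> p)"
      using weak_dx[OF U(1,2) ae_e \<phi>] conv_cont(1)[OF \<phi> position_continuous] conv_\<eta>[OF \<phi>] by simp
    show "(LINT p:half_plane|lebesgue. position p * dt \<phi> p) = - (LINT p:half_plane|lebesgue. G (v p / \<eta> p) * \<phi> p)"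
      using weak_dt[OF \<phi>] conv_cont(2)[OF \<phi> position_continuous] conv_F[OF \<phi>] by simp
  qed
  have unique: "\<gamma>' (x, t) = position (x, t)" if \<gamma>': "distributional_position G \<eta> v \<gamma>'" and t: "0 \<le> t" for \<gamma>' x t
  proof -
    \<comment> \<open>A competitor is continuous on the closed half plane only; its values at
      negative times are replaced by the initial ones.\<close>
    define g where "g p = \<gamma>' (fst p, max 0 (snd p))" for p
    have cg: "continuous_on UNIV g"
      unfolding g_def
      by (rule continuous_on_compose2[of closed_half_plane \<gamma>'])
         (use \<gamma>' in \<open>auto simp: distributional_position_def intro!: continuous_intros\<close>)
    define D where "D p = g p - position p" for p
    have cD: "continuous_on UNIV D" unfolding D_def by (intro continuous_on_diff cg position_continuous)
    have "D (x, t) = 0"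
    proof (rule zero_if_weak_dt_zero[OF cD _ _ t])
      show "D (x, 0) = 0" for x using \<gamma>' by (simp add: D_def g_def position_init distributional_position_def)
      fix \<phi> assume \<phi>: "smooth_test \<phi>"
      have "(LINT p|lborel. g p * dt \<phi> p) = (LINT p:half_plane|lebesgue. \<gamma>' p * dt \<phi> p)"
        by (rule conv_cont(2)[OF \<phi> cg, symmetric]) (auto simp: g_def)
      also have "\<dots> = - (LINT p|lborel. f p * \<phi> p)"
        using \<gamma>' \<phi> conv_F[OF \<phi>] by (simp add: distributional_position_def)
      finally have eq: "(LINT p|lborel. g p * dt \<phi> p) = (LINT p|lborel. position p * dt \<phi> p)"
        using weak_dt[OF \<phi>] by simp
      obtain a b c d where z: "\<And>x t. x \<notin> {a..b} \<or> t \<notin> {c..d} \<Longrightarrow> \<phi> (x, t) = 0 \<and> dx \<phi> (x, t) = 0 \<and> dt \<phi> (x, t) = 0"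
        and cont: "continuous_on UNIV (dt \<phi>)"
        by (rule smooth_test_facts[OF \<phi>]) blast
      have I: "integrable lborel (\<lambda>p. h p * dt \<phi> p)" if h: "continuous_on UNIV h" for h
      proof -
        have ch: "continuous_on UNIV (\<lambda>p. h p * dt \<phi> p)" by (intro continuous_on_mult h cont)
        have zh: "h (x, t) * dt \<phi> (x, t) = 0" if "x \<notin> {a..b} \<or> t \<notin> {c..d}" for x t using z[OF that] by simp
        obtain C where "\<And>p. \<bar>h p * dt \<phi> p\<bar> \<le> C" using bounded_if_zero_off_box[OF ch zh] by blast
        from fubini_box(1)[OF borel_measurable_continuous_onI[OF ch] this zh] show ?thesis .
      qed
      show "(LINT p|lborel. D p * dt \<phi> p) = 0"
        unfolding D_def left_diff_distrib
        using Bochner_Integration.integral_diff[OF I[OF cg] I[OF position_continuous]] eq by simp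
    qed
    then show ?thesis using t by (simp add: D_def g_def)
  qed
  have "abs_continuous (\<lambda>x. position (x, t)) \<and> bij (\<lambda>x. position (x, t)) \<and> abs_continuous (inv (\<lambda>x. position (x, t)))" if t: "0 < t" for t
  \<comment> \<open>At fixed t the offset cancels from differences, so both bounds are bounds on
    \<open>x_primitive\<close>: below from \<open>lower\<close>, above from |\<eta>| \<le>
    B.\<close>
  proof (rule bilipschitz_abs_continuous)
    show "0 < m / M'" using pos_bounds by simp
    show "m / M' * (y - x) \<le> position (y, t) - position (x, t)" if "x \<le> y" for x y
      using lower[OF _ that, of t] t by (simp add: position_def)
    show "\<bar>position (y, t) - position (x, t)\<bar> \<le> B * \<bar>y - x\<bar>" for x y
      using x_primitive_lipschitz[of t y x] t by (simp add: position_def)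
  qed
  with dist unique show ?thesis by blast
qed

end
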